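(* Let $R$ be a ring (with unit $1\ne0$) and let $G$ be a hyperbolic group. Then the $1$-isoperimetric class $\operatorname{DFV}_1^{R,G}$ of $G$ over $R$ with respect to the discrete norm is linear.
   Context: The discrete norm on $R$ is $|r|_d=0$ if $r=0$ and $|r|_d=1$ otherwise. A free $RG$-module with fixed basis $\Lambda$ is given the $\ell^1$-norm obtained by viewing it as a free $R$-module with basis $\Lambda\times G$: $|\sum a_y y|=\sum|a_y|_d$. A projective resolution $(C_k,\partial_k)$ of the trivial $RG$-module $R$ is $n$-admissible if $C_n,C_{n+1}$ are finitely generated free $RG$-modules with fixed free bases (such a resolution exists if $G$ is of type $\mathrm{FP}_{n+1}(R)$). Its $n$-isoperimetric function $f_n\colon\mathbb{R}_{\ge0}\to\mathbb{R}_{\ge0}\cup\{\infty\}$ is $$f_n(l)=\sup\{\inf\{|c| : c\in C_{n+1},\ \partial_{n+1}(c)=b\}\ :\ b\in\operatorname{Im}(\partial_{n+1}),\ |b|\le l\}.$$ For $f,g\colon\mathbb{R}_{\ge0}\to\mathbb{R}_{\ge0}\cup\{\infty\}$ write $f\preccurlyeq g$ if there are constants $C,K>0$ with $f(x)\le Kg(Kx+C)+Kx+C$ for all $x$, and $f\approx g$ if $f\preccurlyeq g$ and $g\preccurlyeq f$. The $\approx$-class of $f_n$ is independent of the $n$-admissible resolution; with respect to the discrete norm it is denoted $\operatorname{DFV}_n^{R,G}$. It is linear if it is the class of $x\mapsto x$, equivalently $f_n(x)\le Kx+C$ for some constants $K,C$. *)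

theory Defs
  imports Complex_Main "HOL-Library.Poly_Mapping" "HOL-Library.Extended_Nonnegative_Real"
begin

text \<open>
  Conventions.  The coefficient ring \<open>R\<close> is a type of class \<open>ring_1\<close> (unital, \<open>1 \<noteq> 0\<close>, not
  necessarily commutative).  The group \<open>G\<close> is a type of class \<open>group_add\<close>: it is written
  additively but is not assumed to be commutative.  The group ring \<open>RG\<close> is then the library ring
  \<open>'g \<Rightarrow>\<^sub>0 'r\<close> of finitely supported functions under convolution.  Modules are left modules.
\<close>

section \<open>Hyperbolic groups\<close>

definition generates :: "'g::group_add set \<Rightarrow> bool" where
  "generates S \<longleftrightarrow> (\<forall>g. \<exists>ws. set ws \<subseteq> S \<union> uminus ` S \<and> sum_list ws = g)"

definition word_length :: "'g::group_add set \<Rightarrow> 'g \<Rightarrow> nat" where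
  "word_length S g =
     (LEAST n. \<exists>ws. length ws = n \<and> set ws \<subseteq> S \<union> uminus ` S \<and> sum_list ws = g)"

definition word_dist :: "'g::group_add set \<Rightarrow> 'g \<Rightarrow> 'g \<Rightarrow> real" where
  "word_dist S g h = real (word_length S (- g + h))"

definition gromov_product :: "('x \<Rightarrow> 'x \<Rightarrow> real) \<Rightarrow> 'x \<Rightarrow> 'x \<Rightarrow> 'x \<Rightarrow> real" where
  "gromov_product d w x y = (d x w + d y w - d x y) / 2"

definition gromov_hyperbolic :: "('x \<Rightarrow> 'x \<Rightarrow> real) \<Rightarrow> bool" where
  "gromov_hyperbolic d \<longleftrightarrow> (\<exists>\<delta>\<ge>0. \<forall>w x y z.
     gromov_product d w x z \<ge> min (gromov_product d w x y) (gromov_product d w y z) - \<delta>)"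

definition hyperbolic_group :: "'g::group_add itself \<Rightarrow> bool" where
  "hyperbolic_group _ \<longleftrightarrow>
     (\<exists>S :: 'g set. finite S \<and> generates S \<and> gromov_hyperbolic (word_dist S))"

section \<open>Modules over a not necessarily commutative ring\<close>

text \<open>The library locale \<open>module\<close> requires a commutative ring of scalars.\<close>

definition left_module :: "('a::ring_1 \<Rightarrow> 'm::ab_group_add \<Rightarrow> 'm) \<Rightarrow> bool" where
  "left_module scale \<longleftrightarrow>
     (\<forall>a x y. scale a (x + y) = scale a x + scale a y) \<and>
     (\<forall>a b x. scale (a + b) x = scale a x + scale b x) \<and>
     (\<forall>a b x. scale (a * b) x = scale a (scale b x)) \<and>
     (\<forall>x. scale 1 x = x)"

definition submodule :: "('a::ring_1 \<Rightarrow> 'm::ab_group_add \<Rightarrow> 'm) \<Rightarrow> 'm set \<Rightarrow> bool" where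
  "submodule scale M \<longleftrightarrow>
     0 \<in> M \<and> (\<forall>x\<in>M. \<forall>y\<in>M. x + y \<in> M) \<and> (\<forall>a. \<forall>x\<in>M. scale a x \<in> M)"

definition left_module_hom ::
  "('a::ring_1 \<Rightarrow> 'm::ab_group_add \<Rightarrow> 'm) \<Rightarrow> 'm set \<Rightarrow>
   ('a \<Rightarrow> 'n::ab_group_add \<Rightarrow> 'n) \<Rightarrow> 'n set \<Rightarrow> ('m \<Rightarrow> 'n) \<Rightarrow> bool" where
  "left_module_hom scale M scale' N f \<longleftrightarrow>
     f ` M \<subseteq> N \<and>
     (\<forall>x\<in>M. \<forall>y\<in>M. f (x + y) = f x + f y) \<and>
     (\<forall>a. \<forall>x\<in>M. f (scale a x) = scale' a (f x))"

text \<open>The free left module on the index type \<open>'i\<close> is \<open>'i \<Rightarrow>\<^sub>0 'a\<close> with this scalar multiplication.\<close>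

definition free_scale :: "'a::ring_1 \<Rightarrow> ('i \<Rightarrow>\<^sub>0 'a) \<Rightarrow> ('i \<Rightarrow>\<^sub>0 'a)" where
  "free_scale a x = Poly_Mapping.map ((*) a) x"

text \<open>
  Projective means: direct summand of a free module.  A free module with basis indexed by the
  elements of the ambient type is large enough, since a projective module is a direct summand of
  every free module that surjects onto it.
\<close>

definition projective ::
  "('a::ring_1 \<Rightarrow> 'm::ab_group_add \<Rightarrow> 'm) \<Rightarrow> 'm set \<Rightarrow> bool" where
  "projective scale M \<longleftrightarrow>
     (\<exists>(s :: 'm \<Rightarrow> ('m \<Rightarrow>\<^sub>0 'a)) p.
        left_module_hom scale M free_scale UNIV s \<and>
        left_module_hom free_scale UNIV scale M p \<and>
        (\<forall>x\<in>M. p (s x) = x))"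

definition represents ::
  "('a::ring_1 \<Rightarrow> 'm::ab_group_add \<Rightarrow> 'm) \<Rightarrow> 'm set \<Rightarrow> 'm \<Rightarrow> ('m \<Rightarrow>\<^sub>0 'a) \<Rightarrow> bool" where
  "represents scale B x a \<longleftrightarrow>
     Poly_Mapping.keys a \<subseteq> B \<and>
     x = (\<Sum>y\<in>Poly_Mapping.keys a. scale (Poly_Mapping.lookup a y) y)"

definition free_basis ::
  "('a::ring_1 \<Rightarrow> 'm::ab_group_add \<Rightarrow> 'm) \<Rightarrow> 'm set \<Rightarrow> 'm set \<Rightarrow> bool" where
  "free_basis scale M B \<longleftrightarrow> B \<subseteq> M \<and> (\<forall>x\<in>M. \<exists>!a. represents scale B x a)"

definition coordinates ::
  "('a::ring_1 \<Rightarrow> 'm::ab_group_add \<Rightarrow> 'm) \<Rightarrow> 'm set \<Rightarrow> 'm \<Rightarrow> ('m \<Rightarrow>\<^sub>0 'a)" where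
  "coordinates scale B x = (THE a. represents scale B x a)"

section \<open>The norm\<close>

definition discrete_norm :: "'r::zero \<Rightarrow> real" where
  "discrete_norm r = (if r = 0 then 0 else 1)"

text \<open>
  An element of a free \<open>RG\<close>-module with basis \<open>B\<close> has \<open>RG\<close>-coordinates \<open>a y\<close> for \<open>y \<in> B\<close>; its
  coefficient at the \<open>R\<close>-basis element \<open>(y, g) \<in> B \<times> G\<close> is the value of \<open>a y\<close> at \<open>g\<close>.
\<close>

definition l1_norm ::
  "(('g::group_add \<Rightarrow>\<^sub>0 'r::ring_1) \<Rightarrow> 'm::ab_group_add \<Rightarrow> 'm) \<Rightarrow> 'm set \<Rightarrow> 'm \<Rightarrow> real" where
  "l1_norm scale B x =
     (let a = coordinates scale B x in
      \<Sum>y\<in>Poly_Mapping.keys a. \<Sum>g\<in>Poly_Mapping.keys (Poly_Mapping.lookup a y).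
        discrete_norm (Poly_Mapping.lookup (Poly_Mapping.lookup a y) g))"

section \<open>Admissible resolutions\<close>

text \<open>The trivial \<open>RG\<close>-module \<open>R\<close>: every group element acts as the identity.\<close>

definition trivial_scale :: "('g::group_add \<Rightarrow>\<^sub>0 'r::ring_1) \<Rightarrow> 'r \<Rightarrow> 'r" where
  "trivial_scale a r = (\<Sum>g\<in>Poly_Mapping.keys a. Poly_Mapping.lookup a g * r)"

text \<open>
  All modules \<open>C\<^sub>k\<close> are submodules of one ambient \<open>RG\<close>-module on the type \<open>'m\<close>.  This is no
  restriction: an arbitrary sequence of modules embeds into its direct sum.  The field \<open>bdry\<close>
  is used in degrees \<open>k \<ge> 1\<close> only, where \<open>bdry k : C\<^sub>k \<rightarrow> C\<^sub>k\<^sub>-\<^sub>1\<close>; in degree \<open>0\<close> there is the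
  augmentation \<open>aug : C\<^sub>0 \<rightarrow> R\<close>.
\<close>

record (overloaded) ('r::zero, 'g, 'm) resolution =
  smul :: "('g \<Rightarrow>\<^sub>0 'r) \<Rightarrow> 'm \<Rightarrow> 'm"
  chains :: "nat \<Rightarrow> 'm set"
  bdry :: "nat \<Rightarrow> 'm \<Rightarrow> 'm"
  aug :: "'m \<Rightarrow> 'r"

definition projective_resolution ::
  "('r::ring_1, 'g::group_add, 'm::ab_group_add) resolution \<Rightarrow> bool" where
  "projective_resolution X \<longleftrightarrow>
     left_module (smul X) \<and>
     (\<forall>k. submodule (smul X) (chains X k) \<and> projective (smul X) (chains X k)) \<and>
     (\<forall>k. left_module_hom (smul X) (chains X (Suc k)) (smul X) (chains X k) (bdry X (Suc k))) \<and>
     left_module_hom (smul X) (chains X 0) trivial_scale UNIV (aug X) \<and>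
     (\<forall>k. bdry X (Suc (Suc k)) ` chains X (Suc (Suc k)) =
          {x \<in> chains X (Suc k). bdry X (Suc k) x = 0}) \<and>
     bdry X (Suc 0) ` chains X (Suc 0) = {x \<in> chains X 0. aug X x = 0} \<and>
     aug X ` chains X 0 = UNIV"

text \<open>
  The fixed bases are given by \<open>B :: nat \<Rightarrow> 'm set\<close>, of which only \<open>B n\<close> and \<open>B (n + 1)\<close> matter.
  As \<open>RG\<close> is not the zero ring, a free module is finitely generated iff a given basis is finite.
\<close>

definition n_admissible ::
  "nat \<Rightarrow> ('r::ring_1, 'g::group_add, 'm::ab_group_add) resolution \<Rightarrow> (nat \<Rightarrow> 'm set) \<Rightarrow> bool" where
  "n_admissible n X B \<longleftrightarrow>
     projective_resolution X \<and>
     (\<forall>k\<in>{n, Suc n}. finite (B k) \<and> free_basis (smul X) (chains X k) (B k))"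

section \<open>Isoperimetric functions\<close>

text \<open>
  Functions \<open>\<real>\<^sub>\<ge>\<^sub>0 \<rightarrow> \<real>\<^sub>\<ge>\<^sub>0 \<union> {\<infinity>}\<close> have type \<open>real \<Rightarrow> ennreal\<close>; only their values at nonnegative
  arguments are ever used.
\<close>

definition isoperimetric_function ::
  "nat \<Rightarrow> ('r::ring_1, 'g::group_add, 'm::ab_group_add) resolution \<Rightarrow> (nat \<Rightarrow> 'm set) \<Rightarrow>
   real \<Rightarrow> ennreal" where
  "isoperimetric_function n X B l =
     (SUP b \<in> {b \<in> bdry X (Suc n) ` chains X (Suc n). l1_norm (smul X) (B n) b \<le> l}.
        INF c \<in> {c \<in> chains X (Suc n). bdry X (Suc n) c = b}.
          ennreal (l1_norm (smul X) (B (Suc n)) c))"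

definition dominated :: "(real \<Rightarrow> ennreal) \<Rightarrow> (real \<Rightarrow> ennreal) \<Rightarrow> bool" (infix \<open>\<preceq>\<^sub>F\<close> 50) where
  "f \<preceq>\<^sub>F g \<longleftrightarrow> (\<exists>C>0. \<exists>K>0. \<forall>x\<ge>0.
     f x \<le> ennreal K * g (K * x + C) + ennreal (K * x + C))"

definition equivalent_growth ::
  "(real \<Rightarrow> ennreal) \<Rightarrow> (real \<Rightarrow> ennreal) \<Rightarrow> bool" (infix \<open>\<approx>\<^sub>F\<close> 50) where
  "f \<approx>\<^sub>F g \<longleftrightarrow> f \<preceq>\<^sub>F g \<and> g \<preceq>\<^sub>F f"

text \<open>
  The class \<open>DFV\<^sub>n\<^sup>R\<^sup>,\<^sup>G\<close>, with resolutions taken inside the type \<open>'m\<close>; the set is empty if \<open>'m\<close>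
  is too small to carry an \<open>n\<close>-admissible resolution.
\<close>

definition DFV ::
  "nat \<Rightarrow> 'r::ring_1 itself \<Rightarrow> 'g::group_add itself \<Rightarrow> 'm::ab_group_add itself \<Rightarrow>
   (real \<Rightarrow> ennreal) set" where
  "DFV n _ _ _ =
     {f. \<exists>(X :: ('r, 'g, 'm) resolution) B.
           n_admissible n X B \<and> f \<approx>\<^sub>F isoperimetric_function n X B}"

definition linear_class :: "(real \<Rightarrow> ennreal) set" where
  "linear_class = {f. f \<approx>\<^sub>F (\<lambda>x. ennreal x)}"

text \<open>
  A type large enough for the direct sum of a free resolution: the free \<open>RG\<close>-module on
  \<open>\<nat> \<times> L\<close>, where \<open>L\<close>, the set of lists over \<open>\<nat> \<times> G \<times> R\<close>, surjects onto the free \<open>RG\<close>-module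
  on \<open>L\<close>.  Hence \<open>C\<^sub>k\<close> may be taken free on a subset of \<open>{k} \<times> L\<close>.
\<close>

type_synonym ('r, 'g) universe = "(nat \<times> (nat \<times> 'g \<times> 'r) list) \<Rightarrow>\<^sub>0 ('g \<Rightarrow>\<^sub>0 'r)"

end

theory Submission
  imports Defs
begin

text \<open>
  A \<open>1\<close>-cycle of support \<open>l\<close> in a Cayley graph is filled by the cone over it: each connected component
  of its support is joined to one of its vertices along a spanning tree of geodesics, and each edge
  spans a thin ladder between the two geodesics at its ends.  The discrete norm ignores
  multiplicities, so the cone costs only a constant times the number of vertices of the hull, the
  union of all these geodesics, rather than the sum of their lengths.

  The hull has linear size.  If one of its points \<open>p\<close> is far from the cycle, the walk inside the cycle
  from a vertex above \<open>p\<close> to the base point has to leave the part of the tree near \<open>p\<close> at height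
  at least \<open>N\<close> above \<open>p\<close>; there it moves a distance of more than \<open>2 N\<close>, past many hull points at
  height exactly \<open>N\<close> above \<open>p\<close>.  For \<open>N\<close> large this double counting shows that at most half of the
  hull is far from the cycle, and the remaining part has linear size.

  An arbitrary \<open>1\<close>-admissible resolution is compared with the standard one in low degrees: as
  \<open>C\<^sub>1\<close> is finitely generated, the chain maps and homotopies change norms by bounded factors only,
  and the edges that occur have bounded length.  Finally, the same cones show that the cycles of the
  Cayley graph are generated by finitely many bounded loops and their translates, which gives a
  \<open>1\<close>-admissible resolution inside the given universe.
\<close>

section \<open>The word metric\<close>

locale hyperbolic_generators =
  fixes S :: "'g::group_add set" and \<delta> :: real
  assumes finite_generators: "finite S"
    and generating: "generates S"
    and hyperbolic: "\<And>w x y z :: 'g. gromov_product (word_dist S) w x z \<ge>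
      min (gromov_product (word_dist S) w x y) (gromov_product (word_dist S) w y z) - \<delta>"
begin

abbreviation len :: "'g \<Rightarrow> nat" where
  "len \<equiv> word_length S"

text \<open>Kept in the natural numbers, unlike \<open>word_dist\<close>, so that truncated
  subtraction and integer division apply.\<close>

abbreviation dst :: "'g \<Rightarrow> 'g \<Rightarrow> nat" where
  "dst u v \<equiv> len (- u + v)"

lemma word_exists:
  "\<exists>ws. length ws = len g \<and> set ws \<subseteq> S \<union> uminus ` S \<and> sum_list ws = g"
proof -
  obtain ws where "set ws \<subseteq> S \<union> uminus ` S \<and> sum_list ws = g"
    using generating unfolding generates_def by blast
  hence "\<exists>n ws. length ws = n \<and> set ws \<subseteq> S \<union> uminus ` S \<and> sum_list ws = g"
    by blast
  thus ?thesis
    unfolding word_length_def by (rule LeastI_ex)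
qed

lemma len_le:
  assumes "set ws \<subseteq> S \<union> uminus ` S"
  shows "len (sum_list ws) \<le> length ws"
  unfolding word_length_def by (rule Least_le) (use assms in blast)

lemma len_0 [simp]: "len 0 = 0"
  using len_le[of "[]"] by simp

lemma len_eq_0_iff [simp]: "len g = 0 \<longleftrightarrow> g = 0"
  using word_exists[of g] by auto

lemma len_add: "len (g + h) \<le> len g + len h"
proof -
  obtain us vs where "length us = len g" "set us \<subseteq> S \<union> uminus ` S" "sum_list us = g"
    "length vs = len h" "set vs \<subseteq> S \<union> uminus ` S" "sum_list vs = h"
    using word_exists by metis
  thus ?thesis
    using len_le[of "us @ vs"] by simp
qed

lemma sum_list_rev_uminus: "sum_list (rev (map uminus ws)) = - sum_list (ws :: 'g list)"
  by (induction ws) (auto simp: minus_add)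

lemma len_uminus_le: "len (- g) \<le> len g"
proof -
  obtain ws where ws: "length ws = len g" "set ws \<subseteq> S \<union> uminus ` S" "sum_list ws = g"
    using word_exists by metis
  have "set (rev (map uminus ws)) \<subseteq> S \<union> uminus ` S"
    using ws(2) by force
  thus ?thesis
    using len_le[of "rev (map uminus ws)"] ws by (simp add: sum_list_rev_uminus)
qed

lemma len_uminus [simp]: "len (- g) = len g"
  using len_uminus_le[of g] len_uminus_le[of "- g"] by simp

lemma dst_commute: "dst u v = dst v u"
  using len_uminus[of "- u + v"] by (simp add: minus_add)

lemma dst_triangle: "dst u w \<le> dst u v + dst v w"
  using len_add[of "- u + v" "- v + w"] by (simp add: add.assoc)

lemma dst_left_invariant [simp]: "dst (g + u) (g + v) = dst u v"
  using minus_add_cancel[of g v] by (simp only: minus_add add.assoc)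

lemma len_le_dst: "len u \<le> dst u v + len v"
  using len_add[of v "- v + u"] dst_commute[of u v] by (simp add: add.assoc[symmetric])

section \<open>Balls and their uniform size\<close>

lemma finite_ball: "finite {g. len g \<le> n}"
proof -
  have "{g. len g \<le> n} \<subseteq> sum_list ` {ws. set ws \<subseteq> S \<union> uminus ` S \<and> length ws \<le> n}"
  proof
    fix g assume "g \<in> {g. len g \<le> n}"
    moreover obtain ws where "length ws = len g" "set ws \<subseteq> S \<union> uminus ` S" "sum_list ws = g"
      using word_exists by metis
    ultimately show "g \<in> sum_list ` {ws. set ws \<subseteq> S \<union> uminus ` S \<and> length ws \<le> n}"
      by (intro image_eqI[of _ _ ws]) auto
  qed
  moreover have "finite {ws. set ws \<subseteq> S \<union> uminus ` S \<and> length ws \<le> n}"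
    using finite_generators by (intro finite_lists_length_le) auto
  ultimately show ?thesis
    using finite_surj by blast
qed

lemma dst_ball_eq: "{v. dst u v \<le> n} = (+) u ` {g. len g \<le> n}"
proof (intro equalityI subsetI)
  fix v assume "v \<in> {v. dst u v \<le> n}"
  thus "v \<in> (+) u ` {g. len g \<le> n}"
    by (intro image_eqI[of _ _ "- u + v"]) (auto simp: add.assoc[symmetric])
qed (auto simp: add.assoc[symmetric])

lemma finite_dst_ball: "finite {v. dst u v \<le> n}"
  unfolding dst_ball_eq using finite_ball by blast

lemma card_dst_ball: "card {v. dst u v \<le> n} = card {g. len g \<le> n}"
  unfolding dst_ball_eq by (rule card_image) (auto simp: inj_on_def)

text \<open>Delete the last letter of a shortest word; as \<open>g\<close> has length
  \<open>Suc n\<close>, the remaining prefix cannot be shorter than \<open>n\<close>.\<close>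

lemma predecessor_exists:
  assumes "len g = Suc n"
  shows "\<exists>h. len h = n \<and> dst h g = 1"
proof -
  obtain ws where ws: "length ws = len g" "set ws \<subseteq> S \<union> uminus ` S" "sum_list ws = g"
    using word_exists by metis
  then obtain us w where us: "ws = us @ [w]"
    using assms by (metis length_Suc_conv_rev)
  have "len (sum_list us) \<le> n" "len w \<le> 1" "g = sum_list us + w"
    using ws us len_le[of us] len_le[of "[w]"] assms by auto
  moreover from this have "dst (sum_list us) g = len w"
    by (simp add: add.assoc[symmetric])
  ultimately have "len (sum_list us) = n \<and> dst (sum_list us) g = 1"
    using len_add[of "sum_list us" w] assms by auto
  thus ?thesis ..
qed

section \<open>A geodesic spanning tree\<close>

text \<open>One predecessor is chosen once and for all, so that geodesics to \<open>0\<close> merge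
  as soon as they meet and form a tree.\<close>

definition parent :: "'g \<Rightarrow> 'g" where
  "parent g = (SOME h. len g = Suc (len h) \<and> dst h g = 1)"

lemma parent:
  assumes "len g > 0"
  shows "len g = Suc (len (parent g))" "dst (parent g) g = 1"
proof -
  obtain n where n: "len g = Suc n" using assms gr0_implies_Suc by blast
  obtain h where "len h = n \<and> dst h g = 1"
    using predecessor_exists[OF n] by blast
  hence "\<exists>h. len g = Suc (len h) \<and> dst h g = 1"
    using n by metis
  hence "len g = Suc (len (parent g)) \<and> dst (parent g) g = 1"
    unfolding parent_def by (rule someI_ex)
  thus "len g = Suc (len (parent g))" "dst (parent g) g = 1" by auto
qed

text \<open>The vertex at height \<open>j\<close> on the chosen geodesic from \<open>0\<close> to
  \<open>g\<close>; truncated subtraction makes it stay at \<open>g\<close> for \<open>j\<close>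
  beyond \<open>len g\<close>.\<close>

definition anc :: "nat \<Rightarrow> 'g \<Rightarrow> 'g" where
  "anc j g = (parent ^^ (len g - j)) g"

lemma iterate_parent:
  "k \<le> len g \<Longrightarrow> len ((parent ^^ k) g) = len g - k \<and> dst ((parent ^^ k) g) g \<le> k"
proof (induction k)
  case (Suc k)
  let ?h = "(parent ^^ k) g"
  have h: "len ?h = len g - k" "dst ?h g \<le> k" using Suc by auto
  hence "len ?h > 0" using Suc.prems by simp
  from parent[OF this] h Suc.prems dst_triangle[of "parent ?h" g ?h] show ?case by auto
qed simp

lemma anc_above: "len g \<le> j \<Longrightarrow> anc j g = g"
  by (simp add: anc_def)

lemma len_anc: "len (anc j g) = min j (len g)"
  using iterate_parent[of "len g - j" g] by (auto simp: anc_def)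

lemma anc_0 [simp]: "anc 0 g = 0"
  using len_anc[of 0 g] by simp

lemma dst_anc_le: "dst (anc j g) g \<le> len g - j"
  using iterate_parent[of "len g - j" g] by (auto simp: anc_def)

text \<open>Both geodesics follow the same parent map, so the one to an ancestor is an initial
  segment of the one to \<open>g\<close>.\<close>

lemma anc_anc:
  assumes "i \<le> j"
  shows "anc i (anc j g) = anc i g"
proof (cases "len g \<le> j")
  case False
  hence "len g - i = (j - i) + (len g - j)" using assms by simp
  hence "(parent ^^ (len g - i)) g = (parent ^^ (j - i)) ((parent ^^ (len g - j)) g)"
    by (simp add: funpow_add)
  moreover have "len ((parent ^^ (len g - j)) g) = j"
    using len_anc[of j g] False by (simp add: anc_def)
  ultimately show ?thesis by (simp add: anc_def)
qed (simp add: anc_above)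

lemma dst_anc:
  assumes "j \<le> len g"
  shows "dst (anc j g) g = len g - j"
  using dst_anc_le[of j g] len_le_dst[of g "anc j g"] dst_commute[of g "anc j g"]
    len_anc[of j g] assms by simp

lemma dst_anc_Suc: "dst (anc j g) (anc (Suc j) g) \<le> 1"
  using dst_anc_le[of j "anc (Suc j) g"] anc_anc[of j "Suc j" g] len_anc[of "Suc j" g]
  by simp

text \<open>The last hypothesis says that \<open>j\<close> is at most the Gromov product of
  \<open>g\<close> and \<open>h\<close> at \<open>0\<close>. Up to that height the two geodesics run
  close together.\<close>

lemma thin_ancestors:
  assumes "j \<le> len g" "j \<le> len h" "2 * j + dst g h \<le> len g + len h"
  shows "real (dst (anc j g) (anc j h)) \<le> 4 * \<delta>"
proof -
  define G where "G = gromov_product (word_dist S) 0"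
  have G: "G x y = (real (len x) + real (len y) - real (dst x y)) / 2" for x y
    by (simp add: G_def gromov_product_def word_dist_def)
  have hyp: "G x z \<ge> min (G x y) (G y z) - \<delta>" for x y z
    using hyperbolic[of 0 x y z] by (simp add: G_def)
  have lens: "len (anc j g) = j" "len (anc j h) = j"
    using assms len_anc by auto
  have "G (anc j g) g = j"
    using dst_anc[OF assms(1)] lens assms(1) by (simp add: G)
  moreover have "G h (anc j h) = j"
    using dst_anc[OF assms(2)] lens assms(2) dst_commute[of h "anc j h"] by (simp add: G)
  moreover have "real (2 * j + dst g h) \<le> real (len g + len h)"
    using assms(3) by (rule of_nat_mono)
  hence "G g h \<ge> j"
    by (simp add: G)
  \<comment> \<open>Two uses of the four-point inequality lose \<open>2 * \<delta>\<close>; the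
    degenerate third instance supplies \<delta> \<ge> 0.\<close>
  ultimately have "G (anc j g) (anc j h) \<ge> j - 2 * \<delta>"
    using hyp[of "anc j g" g h] hyp[of "anc j g" h "anc j h"] hyp[of g g g] by (simp add: min_def split: if_splits)
  thus ?thesis
    using lens by (simp add: G)
qed

text \<open>Above the height covered by \<open>thin_ancestors\<close>, each ancestor is within
  \<open>l\<close> of its own endpoint, whence the term \<open>3 * l\<close>.\<close>

lemma dst_anc_anc:
  assumes "dst g h \<le> l"
  shows "real (dst (anc j g) (anc j h)) \<le> 4 * \<delta> + 3 * real l"
proof -
  have \<delta>: "\<delta> \<ge> 0"
    using hyperbolic[of 0 0 0 0] by (simp add: gromov_product_def)
  have lens: "len g \<le> len h + l" "len h \<le> len g + l"
    using len_le_dst[of g h] len_le_dst[of h g] dst_commute[of g h] assms by auto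
  show ?thesis
  proof (cases "j \<le> len g \<and> j \<le> len h \<and> 2 * j + dst g h \<le> len g + len h")
    case True
    thus ?thesis using thin_ancestors[of j g h] \<delta> by simp
  next
    case False
    hence "len g - j \<le> l" "len h - j \<le> l"
      using lens assms by linarith+
    hence "dst (anc j g) g \<le> l" "dst h (anc j h) \<le> l"
      using dst_anc_le[of j g] dst_anc_le[of j h] dst_commute[of h "anc j h"] by simp_all
    hence "dst (anc j g) (anc j h) \<le> 3 * l"
      using dst_triangle[of "anc j g" "anc j h" g] dst_triangle[of g "anc j h" h] assms by simp
    hence "real (dst (anc j g) (anc j h)) \<le> real (3 * l)"
      by (rule of_nat_mono)
    thus ?thesis using \<delta> by simp
  qed
qed

section \<open>Hulls\<close>

definition tree_hull :: "'g set \<Rightarrow> 'g set" where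
  "tree_hull V = (\<Union>u\<in>V. range (\<lambda>j. anc j u))"

lemma finite_tree_hull: "finite V \<Longrightarrow> finite (tree_hull V)"
proof -
  have "range (\<lambda>j. anc j u) \<subseteq> (\<lambda>j. anc j u) ` {..len u}" for u
  proof
    fix x assume "x \<in> range (\<lambda>j. anc j u)"
    then obtain j where "x = anc j u" by blast
    hence "x = anc (min j (len u)) u"
      by (auto simp: min_def anc_above)
    thus "x \<in> (\<lambda>j. anc j u) ` {..len u}" by simp
  qed
  hence "finite (range (\<lambda>j. anc j u))" for u
    using finite_surj by (metis finite_atMost)
  thus "finite V \<Longrightarrow> finite (tree_hull V)"
    unfolding tree_hull_def by blast
qed

text \<open>The reflexive transitive closure describes the components of \<open>V\<close> at scale
  \<open>l\<close>.\<close>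

definition steps :: "nat \<Rightarrow> 'g set \<Rightarrow> ('g \<times> 'g) set" where
  "steps l V = {(x, y). x \<in> V \<and> y \<in> V \<and> dst x y \<le> l}"

text \<open>The walk from \<open>u\<close> to \<open>0\<close> starts far above \<open>p\<close> and
  has to leave the region above \<open>p\<close> without coming near \<open>p\<close>. Its ancestors
  at height \<open>len p + D * k\<close> therefore spread over a distance of about
  \<open>2 * D * k\<close>.\<close>

lemma many_branches_above:
  assumes D: "4 * \<delta> + 3 * real l \<le> real D" "D > 0"
    and u: "u \<in> V" "(u, 0) \<in> (steps l V)\<^sup>*"
    and p: "p = anc (len p) u"
    and far: "\<And>v. v \<in> V \<Longrightarrow> dst p v > D * k + l + D"
    and k: "k > 0"
  shows "2 * k \<le> card {q \<in> tree_hull V. len q = len p + D * k \<and> dst p (anc (len p) q) \<le> D}"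
    (is "_ \<le> card ?Q")
proof -
  define m where "m = len p"
  define N where "N = D * k"
  have finite_Q: "finite ?Q"
  proof (rule finite_subset)
    show "finite {q. len q \<le> m + N}" by (rule finite_ball)
  qed (auto simp: m_def N_def)
  define good where "good w \<longleftrightarrow> w \<in> V \<and> len w \<ge> m + N \<and> dst p (anc m w) \<le> D" for w
  have goodQ: "anc (m + N) w \<in> ?Q" if "good w" for w
    using that len_anc[of "m + N" w] anc_anc[of m "m + N" w]
    by (auto simp: good_def tree_hull_def m_def N_def)
  \<comment> \<open>A step from a good point cannot drop below height \<open>m + N\<close>: the
    point before it would be within \<open>D + N + l\<close> of \<open>p\<close>, against
    \<open>far\<close>.\<close>
  have high: "len w' \<ge> m + N" if "good w" "w' \<in> V" "dst w w' \<le> l" for w w'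
  proof (rule ccontr)
    assume "\<not> len w' \<ge> m + N"
    hence "len w < m + N + l"
      using len_le_dst[of w w'] that(3) by simp
    moreover have "dst p w \<le> dst p (anc m w) + dst (anc m w) w"
      by (rule dst_triangle)
    ultimately have "dst p w \<le> D + N + l"
      using that(1) dst_anc_le[of m w] unfolding good_def by linarith
    moreover have "w \<in> V" using that(1) by (simp add: good_def)
    ultimately show False using far[of w] by (simp add: N_def)
  qed
  have u_len: "len u \<ge> m + N"
  proof (rule ccontr)
    assume "\<not> len u \<ge> m + N"
    hence "dst p u < N + 1"
      using dst_anc_le[of m u] p by (simp add: m_def)
    thus False using far[OF u(1)] by (simp add: N_def)
  qed
  have good_u: "good u"
    using u(1) u_len p by (simp add: good_def m_def)
  define q0 where "q0 = anc (m + N) u"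
  have q0: "len q0 = m + N" "anc m q0 = p"
    using u_len len_anc[of "m + N" u] anc_anc[of m "m + N" u] p by (auto simp: q0_def m_def)
  \<comment> \<open>Distances from \<open>q0\<close> are cut into \<open>2 * k\<close> intervals of
    length \<open>D\<close>. If the walk missed interval \<open>i\<close>, its ancestors would stay
    in the earlier intervals and all its points would be good.\<close>
  have "\<exists>q\<in>?Q. dst q0 q div D = i" if i: "i < 2 * k" for i
  proof (rule ccontr)
    assume none: "\<not> ?thesis"
    have i0: "i \<noteq> 0"
    proof
      assume "i = 0"
      thus False using none goodQ[OF good_u] by (auto simp: q0_def)
    qed
    have "good w \<and> dst q0 (anc (m + N) w) div D < i" if "(u, w) \<in> (steps l V)\<^sup>*" for w
      using that
    proof induction
      case base
      show ?case using good_u i0 by (simp add: q0_def)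
    next
      case (step w w')
      hence w: "good w" "dst q0 (anc (m + N) w) div D < i" and w': "w' \<in> V" "dst w w' \<le> l"
        by (auto simp: steps_def)
      have len': "len w' \<ge> m + N" by (rule high[OF w(1) w'])
      \<comment> \<open>One step moves the ancestor by at most \<open>D\<close>, so no interval can
        be jumped over.\<close>
      have "real (dst (anc (m + N) w) (anc (m + N) w')) \<le> real D"
        using dst_anc_anc[OF w'(2), of "m + N"] D(1) by simp
      hence "dst q0 (anc (m + N) w') \<le> dst q0 (anc (m + N) w) + D"
        using dst_triangle[of q0 "anc (m + N) w'" "anc (m + N) w"] by simp
      hence "dst q0 (anc (m + N) w') div D \<le> (dst q0 (anc (m + N) w) + D) div D"
        by (rule div_le_mono)
      hence div: "dst q0 (anc (m + N) w') div D \<le> i"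
        using w(2) D(2) by simp
      hence "dst q0 (anc (m + N) w') div D < 2 * k" using i by simp
      hence "dst q0 (anc (m + N) w') < 2 * k * D"
        using D(2) by (simp add: div_less_iff_less_mult)
      hence lt: "dst q0 (anc (m + N) w') \<le> 2 * N" by (simp add: N_def algebra_simps)
      have "len (anc (m + N) w') = m + N" using len' len_anc by simp
      \<comment> \<open>Two points at height \<open>m + N\<close> that are at most
        \<open>2 * N\<close> apart satisfy exactly the condition of \<open>thin_ancestors\<close> at
        height \<open>m\<close>.\<close>
      hence "real (dst (anc m q0) (anc m (anc (m + N) w'))) \<le> 4 * \<delta>"
        using thin_ancestors[of m q0 "anc (m + N) w'"] q0 lt by simp
      also have "\<dots> \<le> real D" using D(1) by simp
      finally have "good w'"
        using w' len' q0(2) anc_anc[of m "m + N" w'] by (simp add: good_def)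
      moreover have "dst q0 (anc (m + N) w') div D \<noteq> i"
        using none goodQ[OF \<open>good w'\<close>] by blast
      ultimately show ?case using div by simp
    qed
    \<comment> \<open>The end \<open>0\<close> of the walk would be good, although its height is
      less than \<open>m + N\<close>.\<close>
    from this[OF u(2)] show False
      using k D(2) by (simp add: good_def N_def)
  qed
  hence "{..<2 * k} \<subseteq> (\<lambda>q. dst q0 q div D) ` ?Q" by blast
  hence "card {..<2 * k} \<le> card ?Q"
    using finite_Q by (rule surj_card_le[rotated])
  thus ?thesis by simp
qed

text \<open>Double counting shows that at most half of the hull is far from \<open>V\<close>; the
  rest lies in balls of fixed radius around \<open>V\<close>.\<close>

lemma card_tree_hull_le:
  "\<exists>K. \<forall>V. finite V \<longrightarrow> (\<forall>u\<in>V. (u, 0) \<in> (steps l V)\<^sup>*) \<longrightarrow> card (tree_hull V) \<le> K * card V"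
proof -
  \<comment> \<open>By \<open>dst_anc_anc\<close>, ancestors of \<open>l\<close>-close points are
    \<open>D\<close>-close at every height.\<close>
  obtain D where D: "4 * \<delta> + 3 * real l \<le> real D" "D > 0"
    by (metis less_eq_real_def linorder_not_less of_nat_0_less_iff reals_Archimedean2 order.strict_trans zero_less_one)
  define k where "k = card {g. len g \<le> D}"
  have k: "k > 0"
    unfolding k_def card_gt_0_iff using finite_ball by (auto intro!: exI[of _ 0])
  define \<rho> where "\<rho> = D * k + l + D"
  show ?thesis
  proof (intro exI allI impI)
    fix V :: "'g set"
    assume V: "finite V" "\<forall>u\<in>V. (u, 0) \<in> (steps l V)\<^sup>*"
    define H where "H = tree_hull V"
    define F where "F = {p \<in> H. \<forall>v\<in>V. dst p v > \<rho>}"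
    define P where "P p q \<longleftrightarrow> len q = len p + D * k \<and> dst p (anc (len p) q) \<le> D" for p q
    have fin: "finite H" "finite F"
      using finite_tree_hull[OF V(1)] by (auto simp: H_def F_def)
    \<comment> \<open>Count pairs with \<open>P p q\<close>: a far point \<open>p\<close> has at
      least \<open>2 * k\<close> partners, while \<open>q\<close> has at most \<open>k\<close>, all
      of them in one ball of radius \<open>D\<close>.\<close>
    have "2 * k * card F = (\<Sum>p\<in>F. 2 * k)" by simp
    also have "\<dots> \<le> (\<Sum>p\<in>F. card {q \<in> H. P p q})"
    proof (rule sum_mono)
      fix p assume p: "p \<in> F"
      then obtain u j where u: "u \<in> V" "p = anc j u"
        by (auto simp: F_def H_def tree_hull_def)
      have "anc (len p) u = p"
        using u(2) len_anc[of j u] by (auto simp: min_def anc_above)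
      from many_branches_above[OF D u(1) _ this[symmetric] _ k] V(2) u(1) p
      show "2 * k \<le> card {q \<in> H. P p q}"
        by (auto simp: F_def H_def P_def \<rho>_def)
    qed
    also have "\<dots> = (\<Sum>q\<in>H. card {p \<in> F. P p q})"
      using sum.swap_restrict[OF fin(2,1), of "\<lambda>_ _. 1 :: nat" P] by simp
    also have "\<dots> \<le> (\<Sum>q\<in>H. k)"
    proof (rule sum_mono)
      fix q
      have "{p \<in> F. P p q} \<subseteq> {v. dst (anc (len q - D * k) q) v \<le> D}"
        using dst_commute by (auto simp: P_def)
      hence "card {p \<in> F. P p q} \<le> card {v. dst (anc (len q - D * k) q) v \<le> D}"
        by (rule card_mono[OF finite_dst_ball])
      thus "card {p \<in> F. P p q} \<le> k"
        by (simp add: card_dst_ball k_def)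
    qed
    also have "\<dots> = k * card H" by simp
    finally have F_le: "2 * card F \<le> card H" using k by simp
    have "H - F \<subseteq> (\<Union>v\<in>V. {p. dst v p \<le> \<rho>})"
      using dst_commute by (auto simp: F_def not_less)
    hence "card (H - F) \<le> card (\<Union>v\<in>V. {p. dst v p \<le> \<rho>})"
      by (rule card_mono[rotated]) (use V(1) finite_dst_ball in blast)
    also have "\<dots> \<le> (\<Sum>v\<in>V. card {p. dst v p \<le> \<rho>})"
      by (rule card_UN_le[OF V(1)])
    finally have "card (H - F) \<le> card V * card {g. len g \<le> \<rho>}"
      by (simp add: card_dst_ball)
    moreover have "card (H - F) = card H - card F"
      using fin by (intro card_Diff_subset) (auto simp: F_def)
    ultimately show "card (tree_hull V) \<le> (2 * card {g. len g \<le> \<rho>}) * card V"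
      using F_le by (simp add: H_def algebra_simps)
  qed
qed

end

section \<open>Left modules and free modules\<close>

lemma lookup_free_scale [simp]:
  "Poly_Mapping.lookup (free_scale a x) i = a * Poly_Mapping.lookup x i"
  by (simp add: free_scale_def Poly_Mapping.map.rep_eq when_def)

lemma keys_free_scale: "Poly_Mapping.keys (free_scale a x) \<subseteq> Poly_Mapping.keys x"
  by (auto simp: in_keys_iff)

lemma free_scale_single [simp]:
  "free_scale a (Poly_Mapping.single i c) = Poly_Mapping.single i (a * c)"
  by (rule poly_mapping_eqI) (simp add: lookup_single when_def)

lemma left_module_free_scale: "left_module free_scale"
  unfolding left_module_def
  by (auto intro!: poly_mapping_eqI simp: lookup_add algebra_simps)

lemma left_module_mult: "left_module ((*) :: 'a::ring_1 \<Rightarrow> 'a \<Rightarrow> 'a)"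
  by (simp add: left_module_def algebra_simps)

lemma submodule_UNIV [simp]: "submodule scale UNIV"
  by (simp add: submodule_def)

lemma poly_mapping_eq_sum_single:
  assumes "finite A" "Poly_Mapping.keys p \<subseteq> A"
  shows "p = (\<Sum>i\<in>A. Poly_Mapping.single i (Poly_Mapping.lookup p i))"
proof (rule poly_mapping_eqI)
  fix k
  have "Poly_Mapping.lookup (\<Sum>i\<in>A. Poly_Mapping.single i (Poly_Mapping.lookup p i)) k
      = (\<Sum>i\<in>A. if i = k then Poly_Mapping.lookup p k else 0)"
    unfolding lookup_sum by (rule sum.cong) (auto simp: lookup_single when_def)
  also have "\<dots> = Poly_Mapping.lookup p k"
    using assms by (auto simp: in_keys_iff)
  finally show "Poly_Mapping.lookup p k =
    Poly_Mapping.lookup (\<Sum>i\<in>A. Poly_Mapping.single i (Poly_Mapping.lookup p i)) k" ..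
qed

lemma additive_sum:
  fixes f :: "'b::ab_group_add \<Rightarrow> 'c::ab_group_add"
  assumes "\<And>x y. f (x + y) = f x + f y"
  shows "f (sum n A) = (\<Sum>i\<in>A. f (n i))"
proof -
  interpret f: additive f using assms by unfold_locales
  show ?thesis by (rule f.sum)
qed

text \<open>The linear map on the free module that sends the unit vector at \<open>i\<close> to
  \<open>n i\<close>; evaluating coordinates is the case \<open>n = id\<close>.\<close>

definition lin :: "('a::ring_1 \<Rightarrow> 'm::ab_group_add \<Rightarrow> 'm) \<Rightarrow> ('i \<Rightarrow> 'm) \<Rightarrow> ('i \<Rightarrow>\<^sub>0 'a) \<Rightarrow> 'm" where
  "lin scale n a = (\<Sum>y\<in>Poly_Mapping.keys a. scale (Poly_Mapping.lookup a y) (n y))"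

locale lmodule =
  fixes scale :: "'a::ring_1 \<Rightarrow> 'm::ab_group_add \<Rightarrow> 'm"
  assumes left_module: "left_module scale"
begin

lemma scale_right_distrib: "scale a (x + y) = scale a x + scale a y"
  and scale_left_distrib: "scale (a + b) x = scale a x + scale b x"
  and scale_scale: "scale a (scale b x) = scale (a * b) x"
  and scale_one [simp]: "scale 1 x = x"
  using left_module by (simp_all add: left_module_def)

lemma scale_zero_left [simp]: "scale 0 x = 0"
  using scale_left_distrib[of 0 0 x] by simp

lemma scale_zero_right [simp]: "scale a 0 = 0"
  using scale_right_distrib[of a 0 0] by simp

lemma scale_minus_left: "scale (- a) x = - scale a x"
  using scale_left_distrib[of a "- a" x] by (simp add: eq_neg_iff_add_eq_0 add.commute)

lemma scale_minus_right: "scale a (- x) = - scale a x"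
  using scale_right_distrib[of a x "- x"] by (simp add: eq_neg_iff_add_eq_0 add.commute)

lemma scale_diff_right: "scale a (x - y) = scale a x - scale a y"
  using scale_right_distrib[of a x "- y"] by (simp add: scale_minus_right)

lemma scale_diff_left: "scale (a - b) x = scale a x - scale b x"
  using scale_left_distrib[of a "- b" x] by (simp add: scale_minus_left)

lemma scale_sum_right: "scale a (sum n A) = (\<Sum>i\<in>A. scale a (n i))"
  by (rule additive_sum) (rule scale_right_distrib)

lemma scale_sum_left: "scale (sum n A) x = (\<Sum>i\<in>A. scale (n i) x)"
  by (rule additive_sum) (rule scale_left_distrib)

section \<open>Linear extensions and submodules\<close>

lemma lin_superset:
  assumes "finite A" "Poly_Mapping.keys a \<subseteq> A"
  shows "lin scale n a = (\<Sum>y\<in>A. scale (Poly_Mapping.lookup a y) (n y))"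
  unfolding lin_def by (rule sum.mono_neutral_left) (use assms in \<open>auto simp: in_keys_iff\<close>)

lemma lin_add: "lin scale n (a + b) = lin scale n a + lin scale n b"
proof -
  let ?A = "Poly_Mapping.keys a \<union> Poly_Mapping.keys b"
  have "Poly_Mapping.keys (a + b) \<subseteq> ?A" by (rule Poly_Mapping.keys_add)
  thus ?thesis
    by (simp add: lin_superset[of ?A] lookup_add scale_left_distrib sum.distrib)
qed

lemma lin_single [simp]: "lin scale n (Poly_Mapping.single i c) = scale c (n i)"
  by (simp add: lin_superset[of "{i}"])

lemma lin_zero [simp]: "lin scale n 0 = 0"
  by (simp add: lin_def)

lemma lin_sum: "lin scale n (sum f A) = (\<Sum>i\<in>A. lin scale n (f i))"
  by (rule additive_sum) (rule lin_add)

lemma lin_diff: "lin scale n (a - b) = lin scale n a - lin scale n b"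
  using lin_add[of n "a - b" b] by (simp add: algebra_simps)

lemma lin_free_scale: "lin scale n (free_scale c a) = scale c (lin scale n a)"
  unfolding lin_superset[OF finite_keys keys_free_scale[of c a]]
  by (simp add: lin_def scale_sum_right scale_scale)

lemma lin_cong: "(\<And>i. i \<in> Poly_Mapping.keys a \<Longrightarrow> n i = n' i) \<Longrightarrow> lin scale n a = lin scale n' a"
  by (simp add: lin_def)

lemma submodule_uminus: "submodule scale M \<Longrightarrow> x \<in> M \<Longrightarrow> - x \<in> M"
  using scale_minus_left[of 1 x] by (metis scale_one submodule_def)

lemma submodule_diff: "submodule scale M \<Longrightarrow> x \<in> M \<Longrightarrow> y \<in> M \<Longrightarrow> x - y \<in> M"
  using submodule_uminus[of M y] by (metis diff_conv_add_uminus submodule_def)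

lemma submodule_sum:
  assumes "submodule scale M" "\<And>i. i \<in> A \<Longrightarrow> f i \<in> M"
  shows "sum f A \<in> M"
  using assms(2) by (induction A rule: infinite_finite_induct)
    (use assms(1) in \<open>auto simp: submodule_def\<close>)

lemma submodule_lin:
  assumes "submodule scale M" "\<And>i. i \<in> Poly_Mapping.keys a \<Longrightarrow> n i \<in> M"
  shows "lin scale n a \<in> M"
  unfolding lin_def using assms by (intro submodule_sum) (auto simp: submodule_def)

lemma left_module_hom_lin:
  assumes "submodule scale M" "\<And>i. n i \<in> M"
  shows "left_module_hom free_scale UNIV scale M (lin scale n)"
  using assms by (auto simp: left_module_hom_def lin_add lin_free_scale intro: submodule_lin)

end

lemma lin_free_scale_single: "lin free_scale (\<lambda>i. Poly_Mapping.single i 1) a = a"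
  using poly_mapping_eq_sum_single[of "Poly_Mapping.keys a" a] by (simp add: lin_def)

text \<open>Modules are carrier sets inside ambient types, so \<open>f\<close> is linear on
  \<open>M\<close> only.\<close>

locale lmodule_hom = src: lmodule scale + tgt: lmodule scale'
  for scale :: "'a::ring_1 \<Rightarrow> 'm::ab_group_add \<Rightarrow> 'm"
    and scale' :: "'a \<Rightarrow> 'n::ab_group_add \<Rightarrow> 'n" +
  fixes M :: "'m set" and N :: "'n set" and f :: "'m \<Rightarrow> 'n"
  assumes submodule: "submodule scale M" and hom: "left_module_hom scale M scale' N f"
begin

lemma maps_to: "x \<in> M \<Longrightarrow> f x \<in> N"
  and add: "x \<in> M \<Longrightarrow> y \<in> M \<Longrightarrow> f (x + y) = f x + f y"
  and scale: "x \<in> M \<Longrightarrow> f (scale a x) = scale' a (f x)"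
  using hom by (auto simp: left_module_hom_def)

lemma zero [simp]: "f 0 = 0"
  using add[of 0 0] submodule by (simp add: submodule_def)

lemma diff: "x \<in> M \<Longrightarrow> y \<in> M \<Longrightarrow> f (x - y) = f x - f y"
  using add[of "x - y" y] src.submodule_diff[OF submodule, of x y] by (simp add: algebra_simps)

lemma sum:
  assumes "\<And>i. i \<in> A \<Longrightarrow> n i \<in> M"
  shows "f (sum n A) = (\<Sum>i\<in>A. f (n i))"
  using assms
  by (induction A rule: infinite_finite_induct)
    (auto simp: add src.submodule_sum[OF submodule])

lemma lin:
  assumes "\<And>i. i \<in> Poly_Mapping.keys a \<Longrightarrow> n i \<in> M"
  shows "f (lin scale n a) = lin scale' (\<lambda>i. f (n i)) a"
proof -
  have "scale c (n i) \<in> M" if "i \<in> Poly_Mapping.keys a" for c i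
    using assms that submodule by (auto simp: submodule_def)
  thus ?thesis
    unfolding lin_def using assms by (simp add: sum scale)
qed

end

text \<open>Lift the images \<open>e y\<close> of the free basis through \<open>q\<close>, extend
  linearly and compose with the section \<open>s\<close>. Comparing images instead of asking
  \<open>q\<close> to be surjective lets exactness be used directly.\<close>

lemma projective_lift:
  fixes scale0 :: "'a::ring_1 \<Rightarrow> 'm0::ab_group_add \<Rightarrow> 'm0"
    and scale1 :: "'a \<Rightarrow> 'm1::ab_group_add \<Rightarrow> 'm1"
    and scale2 :: "'a \<Rightarrow> 'm2::ab_group_add \<Rightarrow> 'm2"
  assumes "left_module scale0" "left_module scale1" "left_module scale2"
    and "submodule scale0 M0" "submodule scale2 M2"
    and proj: "projective scale0 M0"
    and f: "left_module_hom scale0 M0 scale1 M1 f"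
    and q: "left_module_hom scale2 M2 scale1 M1' q"
    and im: "f ` M0 \<subseteq> q ` M2"
  shows "\<exists>h. left_module_hom scale0 M0 scale2 M2 h \<and> (\<forall>x\<in>M0. q (h x) = f x)"
proof -
  interpret f: lmodule_hom scale0 scale1 M0 M1 f
    using assms by unfold_locales
  interpret q: lmodule_hom scale2 scale1 M2 M1' q
    using assms by unfold_locales
  obtain s :: "'m0 \<Rightarrow> 'm0 \<Rightarrow>\<^sub>0 'a" and p where s: "left_module_hom scale0 M0 free_scale UNIV s"
    and p: "left_module_hom free_scale UNIV scale0 M0 p" and ps: "\<And>x. x \<in> M0 \<Longrightarrow> p (s x) = x"
    using proj unfolding projective_def by blast
  interpret p: lmodule_hom free_scale scale0 UNIV M0 p
    using assms(1) p left_module_free_scale by unfold_locales auto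
  define e where "e y = p (Poly_Mapping.single y 1)" for y
  have e: "e y \<in> M0" for y
    unfolding e_def by (rule p.maps_to) simp
  have "\<exists>n\<in>M2. q n = f (e y)" for y
    using im e[of y] by (metis image_iff subsetD imageI)
  then obtain n where n: "\<And>y. n y \<in> M2" "\<And>y. q (n y) = f (e y)" by metis
  have "q (lin scale2 n a) = f (p a)" for a
  proof -
    have "p a = lin scale0 e a"
      using p.lin[of a "\<lambda>y. Poly_Mapping.single y 1"] by (simp add: lin_free_scale_single e_def[abs_def])
    thus ?thesis
      using q.lin[of a n] f.lin[of a e] n e by simp
  qed
  hence "\<forall>x\<in>M0. q (lin scale2 n (s x)) = f x"
    using ps by simp
  moreover have "left_module_hom scale0 M0 scale2 M2 (\<lambda>x. lin scale2 n (s x))"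
    using s q.src.left_module_hom_lin[OF assms(5), of n] n(1) by (auto simp: left_module_hom_def image_subset_iff)
  ultimately show ?thesis by (intro exI[of _ "\<lambda>x. lin scale2 n (s x)"] conjI)
qed

section \<open>The group ring\<close>

definition augmentation :: "('g::group_add \<Rightarrow>\<^sub>0 'r::ring_1) \<Rightarrow> 'r" where
  "augmentation a = lin (*) (\<lambda>_. 1) a"

interpretation mult: lmodule "(*) :: 'r::ring_1 \<Rightarrow> 'r \<Rightarrow> 'r"
  using left_module_mult by unfold_locales

interpretation free: lmodule "free_scale :: 'a::ring_1 \<Rightarrow> ('i \<Rightarrow>\<^sub>0 'a) \<Rightarrow> _"
  using left_module_free_scale by unfold_locales

lemma augmentation_add: "augmentation (a + b) = augmentation a + augmentation b"
  and augmentation_single [simp]: "augmentation (Poly_Mapping.single g r) = r"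
  and augmentation_sum: "augmentation (sum f A) = (\<Sum>i\<in>A. augmentation (f i))"
  and augmentation_diff: "augmentation (a - b) = augmentation a - augmentation b"
  and augmentation_zero [simp]: "augmentation 0 = 0"
  by (simp_all add: augmentation_def mult.lin_add mult.lin_sum mult.lin_diff)

lemma augmentation_one [simp]: "augmentation 1 = 1"
  using augmentation_single[of 0 1] by simp

lemma trivial_scale_eq: "trivial_scale a r = augmentation a * r"
  by (simp add: trivial_scale_def augmentation_def lin_def sum_distrib_right)

text \<open>Both sides are biadditive, so single terms suffice; there the coefficients multiply in
  the right order.\<close>

lemma augmentation_mult:
  fixes a b :: "'g::group_add \<Rightarrow>\<^sub>0 'r::ring_1"
  shows "augmentation (a * b) = augmentation a * augmentation b"
proof -
  have "augmentation ((\<Sum>g\<in>A. Poly_Mapping.single g (x g)) * (\<Sum>h\<in>B. Poly_Mapping.single h (y h)))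
      = augmentation (\<Sum>g\<in>A. Poly_Mapping.single g (x g)) * augmentation (\<Sum>h\<in>B. Poly_Mapping.single h (y h))"
    for A B and x y :: "'g \<Rightarrow> 'r"
    by (simp add: sum_product mult_single augmentation_sum)
  from this[of "Poly_Mapping.lookup a" "Poly_Mapping.keys a" "Poly_Mapping.lookup b" "Poly_Mapping.keys b"]
  show ?thesis
    by (simp add: poly_mapping_eq_sum_single[symmetric])
qed

lemma left_module_trivial_scale: "left_module trivial_scale"
  by (simp add: left_module_def trivial_scale_eq augmentation_add augmentation_mult algebra_simps)

locale group_ring_module = lmodule scale
  for scale :: "('g::group_add \<Rightarrow>\<^sub>0 'r::ring_1) \<Rightarrow> 'm::ab_group_add \<Rightarrow> 'm"
begin

text \<open>Restriction of scalars to \<open>R\<close>, for arguments that do not respect the action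
  of the group.\<close>

lemma left_module_restrict: "left_module (\<lambda>r. scale (Poly_Mapping.single 0 r))"
  by (simp add: left_module_def scale_right_distrib scale_left_distrib single_add scale_scale
      mult_single)

end

section \<open>The norm of a free module\<close>

text \<open>The support over the \<open>R\<close>-basis of pairs; its size is the discrete
  norm.\<close>

definition supp :: "('i \<Rightarrow>\<^sub>0 ('g \<Rightarrow>\<^sub>0 'r::zero)) \<Rightarrow> ('i \<times> 'g) set" where
  "supp a = (SIGMA y:Poly_Mapping.keys a. Poly_Mapping.keys (Poly_Mapping.lookup a y))"

lemma supp_iff: "(y, g) \<in> supp a \<longleftrightarrow> Poly_Mapping.lookup (Poly_Mapping.lookup a y) g \<noteq> 0"
  by (auto simp: supp_def in_keys_iff)

lemma finite_supp [simp]: "finite (supp a)"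
  by (simp add: supp_def)

lemma supp_zero [simp]: "supp 0 = {}"
  by (simp add: supp_def)

lemma supp_add: "supp (a + b) \<subseteq> supp a \<union> supp b"
  by (auto simp: supp_iff lookup_add)

lemma card_supp_add:
  fixes a b :: "'i \<Rightarrow>\<^sub>0 'g \<Rightarrow>\<^sub>0 'r::monoid_add"
  shows "card (supp (a + b)) \<le> card (supp a) + card (supp b)"
  using card_mono[OF _ supp_add, of a b] card_Un_le[of "supp a" "supp b"] by simp

text \<open>Only an inclusion, because \<open>r\<close> may annihilate coefficients.\<close>

lemma supp_free_scale:
  "supp (free_scale (Poly_Mapping.single h r) a) \<subseteq> (\<lambda>(y, g). (y, h + g)) ` supp a"
proof
  fix x assume x: "x \<in> supp (free_scale (Poly_Mapping.single h r) a)"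
  obtain y g where yg: "x = (y, g)" by fastforce
  have "g \<in> Poly_Mapping.keys (Poly_Mapping.single h r * Poly_Mapping.lookup a y)"
    using x by (simp add: yg supp_iff in_keys_iff)
  then obtain k where "k \<in> Poly_Mapping.keys (Poly_Mapping.lookup a y)" "g = h + k"
    using keys_mult[of "Poly_Mapping.single h r" "Poly_Mapping.lookup a y"]
    by (auto split: if_splits)
  moreover from this have "(y, k) \<in> supp a"
    by (simp add: supp_iff in_keys_iff)
  ultimately show "x \<in> (\<lambda>(y, g). (y, h + g)) ` supp a"
    unfolding yg by (intro image_eqI[of _ _ "(y, k)"]) simp_all
qed

lemma card_supp_free_scale:
  "card (supp (free_scale (Poly_Mapping.single h r) a)) \<le> card (supp a)"
  by (rule order.trans[OF card_mono[OF _ supp_free_scale] card_image_le]) simp_all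

lemma (in group_ring_module) lin_eq_sum_supp:
  "lin scale n a = (\<Sum>(y, g)\<in>supp a.
    scale (Poly_Mapping.single g (Poly_Mapping.lookup (Poly_Mapping.lookup a y) g)) (n y))"
proof -
  have scale_eq: "scale p x = (\<Sum>g\<in>Poly_Mapping.keys p. scale (Poly_Mapping.single g (Poly_Mapping.lookup p g)) x)"
    for p x
    using arg_cong[OF poly_mapping_eq_sum_single[of "Poly_Mapping.keys p" p], of "\<lambda>q. scale q x"]
    unfolding scale_sum_left by simp
  have "lin scale n a = (\<Sum>y\<in>Poly_Mapping.keys a. \<Sum>g\<in>Poly_Mapping.keys (Poly_Mapping.lookup a y).
      scale (Poly_Mapping.single g (Poly_Mapping.lookup (Poly_Mapping.lookup a y) g)) (n y))"
    unfolding lin_def by (rule sum.cong[OF refl scale_eq])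
  also have "\<dots> = (\<Sum>(y, g)\<in>supp a.
      scale (Poly_Mapping.single g (Poly_Mapping.lookup (Poly_Mapping.lookup a y) g)) (n y))"
    unfolding supp_def by (rule sum.Sigma) auto
  finally show ?thesis .
qed

locale based_module = group_ring_module scale
  for scale :: "('g::group_add \<Rightarrow>\<^sub>0 'r::ring_1) \<Rightarrow> 'm::ab_group_add \<Rightarrow> 'm" +
  fixes M B :: "'m set"
  assumes submodule: "submodule scale M" and basis: "free_basis scale M B"
begin

abbreviation "coords \<equiv> coordinates scale B"

lemma represents_coords: "x \<in> M \<Longrightarrow> represents scale B x (coords x)"
  unfolding coordinates_def by (rule theI') (use basis in \<open>simp add: free_basis_def\<close>)

lemma coords_eqI: "x \<in> M \<Longrightarrow> represents scale B x a \<Longrightarrow> coords x = a"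
  using basis unfolding coordinates_def free_basis_def by (intro the1_equality) simp_all

lemma represents_iff: "represents scale B x a \<longleftrightarrow> Poly_Mapping.keys a \<subseteq> B \<and> lin scale id a = x"
  by (auto simp: represents_def lin_def)

lemma lin_coords: "x \<in> M \<Longrightarrow> lin scale id (coords x) = x"
  and keys_coords: "x \<in> M \<Longrightarrow> Poly_Mapping.keys (coords x) \<subseteq> B"
  using represents_coords[of x] by (simp_all add: represents_iff)

lemma coords_zero: "coords 0 = 0"
  by (rule coords_eqI) (use submodule in \<open>auto simp: represents_iff submodule_def\<close>)

lemma coords_add: "x \<in> M \<Longrightarrow> y \<in> M \<Longrightarrow> coords (x + y) = coords x + coords y"
  using submodule Poly_Mapping.keys_add[of "coords x" "coords y"] keys_coords[of x] keys_coords[of y]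
  by (intro coords_eqI) (auto simp: represents_iff lin_add lin_coords submodule_def)

lemma coords_scale: "x \<in> M \<Longrightarrow> coords (scale c x) = free_scale c (coords x)"
  using submodule keys_free_scale[of c "coords x"] keys_coords[of x]
  by (intro coords_eqI) (auto simp: represents_iff lin_free_scale lin_coords submodule_def)

lemma l1_norm_eq: "l1_norm scale B x = card (supp (coords x))"
proof -
  have "(\<Sum>g\<in>Poly_Mapping.keys p. discrete_norm (Poly_Mapping.lookup p g))
      = (\<Sum>g\<in>Poly_Mapping.keys p. 1)" for p :: "'g \<Rightarrow>\<^sub>0 'r"
    by (rule sum.cong) (auto simp: discrete_norm_def in_keys_iff)
  thus ?thesis
    by (simp add: l1_norm_def Let_def supp_def)
qed

end

text \<open>The common properties of the discrete norms on a based module and on the standard free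
  module. Multiplying by a coefficient never increases such a norm, however large a multiplicity it
  stands for.\<close>

definition subadditive_norm ::
  "(('g::group_add \<Rightarrow>\<^sub>0 'r::ring_1) \<Rightarrow> 'm::ab_group_add \<Rightarrow> 'm) \<Rightarrow> 'm set \<Rightarrow> ('m \<Rightarrow> real) \<Rightarrow> bool" where
  "subadditive_norm scale M N \<longleftrightarrow> N 0 = 0 \<and> (\<forall>x\<in>M. \<forall>y\<in>M. N (x + y) \<le> N x + N y) \<and>
     (\<forall>g r. \<forall>x\<in>M. N (scale (Poly_Mapping.single g r) x) \<le> N x)"

lemma subadditive_norm_supp: "subadditive_norm free_scale UNIV (\<lambda>a. real (card (supp a)))"
  by (simp add: subadditive_norm_def card_supp_free_scale card_supp_add flip: of_nat_add)

lemma (in based_module) subadditive_l1_norm: "subadditive_norm scale M (l1_norm scale B)"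
  by (simp add: subadditive_norm_def l1_norm_eq coords_zero coords_add coords_scale
      card_supp_free_scale card_supp_add flip: of_nat_add)

lemma (in group_ring_module) subadditive_norm_sum:
  assumes "submodule scale M" "subadditive_norm scale M N" "\<And>i. i \<in> A \<Longrightarrow> n i \<in> M"
  shows "N (\<Sum>i\<in>A. scale (Poly_Mapping.single (g i) (r i)) (n i)) \<le> (\<Sum>i\<in>A. N (n i))"
proof -
  show ?thesis
    using assms(3)
  proof (induction A rule: infinite_finite_induct)
    case (insert i A)
    let ?s = "\<lambda>i. scale (Poly_Mapping.single (g i) (r i)) (n i)"
    have s: "?s j \<in> M" if "j \<in> insert i A" for j
      using insert.prems[OF that] assms(1) by (auto simp: submodule_def)
    hence "N (?s i + (\<Sum>i\<in>A. ?s i)) \<le> N (?s i) + N (\<Sum>i\<in>A. ?s i)"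
      using assms(2) submodule_sum[OF assms(1), of A ?s] by (auto simp: subadditive_norm_def)
    moreover have "N (?s i) \<le> N (n i)"
      using assms(2) insert.prems by (auto simp: subadditive_norm_def)
    ultimately show ?case
      using insert by fastforce
  qed (use assms(2) in \<open>auto simp: subadditive_norm_def\<close>)
qed

text \<open>An element of norm \<open>n\<close> is a sum of \<open>n\<close> translated and scaled
  basis elements, and each contributes at most the largest norm of an image of one of the finitely
  many basis elements.\<close>

lemma (in based_module) hom_bounded:
  fixes scale' :: "('g \<Rightarrow>\<^sub>0 'r) \<Rightarrow> 'n::ab_group_add \<Rightarrow> 'n"
  assumes "left_module scale'" "submodule scale' M'" "subadditive_norm scale' M' N"
    and hom: "left_module_hom scale M scale' M' f" and "finite B"
  shows "\<exists>K\<ge>0. \<forall>x\<in>M. N (f x) \<le> K * l1_norm scale B x"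
proof (intro exI conjI ballI)
  interpret f: lmodule_hom scale scale' M M' f
    using assms submodule by unfold_locales
  interpret tgt: group_ring_module scale' ..
  \<comment> \<open>The absolute values make every summand nonnegative, so that each is bounded by
    the sum.\<close>
  let ?K = "\<Sum>y\<in>B. \<bar>N (f y)\<bar>"
  show "?K \<ge> 0" by (simp add: sum_nonneg)
  have BM: "B \<subseteq> M" using basis by (simp add: free_basis_def)
  fix x assume x: "x \<in> M"
  have keys: "Poly_Mapping.keys (coords x) \<subseteq> M"
    using keys_coords[OF x] BM by blast
  have "f x = f (lin scale id (coords x))"
    using x by (simp add: lin_coords)
  also have "\<dots> = lin scale' f (coords x)"
    using keys f.lin[of "coords x" id] by auto
  also have "N \<dots> \<le> (\<Sum>yg\<in>supp (coords x). N (f (fst yg)))"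
    unfolding tgt.lin_eq_sum_supp case_prod_unfold
    by (rule tgt.subadditive_norm_sum[OF assms(2,3)]) (use keys f.maps_to in \<open>auto simp: supp_def\<close>)
  also have "\<dots> \<le> (\<Sum>yg\<in>supp (coords x). ?K)"
  proof (rule sum_mono)
    fix yg assume "yg \<in> supp (coords x)"
    hence "fst yg \<in> B" using keys_coords[OF x] by (auto simp: supp_def)
    hence "\<bar>N (f (fst yg))\<bar> \<le> ?K"
      using assms(5) by (intro member_le_sum) auto
    thus "N (f (fst yg)) \<le> ?K" by simp
  qed
  also have "\<dots> = ?K * l1_norm scale B x"
    by (simp add: l1_norm_eq)
  finally show "N (f x) \<le> ?K * l1_norm scale B x" .
qed

section \<open>Filling cycles by cones\<close>

text \<open>\<open>\<kappa> s\<close> stands for an edge from \<open>0\<close> to \<open>s\<close>,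
  realised in an arbitrary module. The same cones then serve both to fill in a given resolution and
  to build one.\<close>

locale cone = hyperbolic_generators S \<delta> + group_ring_module scale
  for S :: "'g::group_add set" and \<delta> :: real
    and scale :: "('g \<Rightarrow>\<^sub>0 'r::ring_1) \<Rightarrow> 'm::ab_group_add \<Rightarrow> 'm" +
  fixes \<kappa> :: "'g \<Rightarrow> 'm"
  assumes \<kappa>_zero: "\<kappa> 0 = 0"
begin

abbreviation translate :: "'g \<Rightarrow> 'r \<Rightarrow> 'm \<Rightarrow> 'm" where
  "translate g r \<equiv> scale (Poly_Mapping.single g r)"

lemma translate_translate: "translate g r (translate h s x) = translate (g + h) (r * s) x"
  by (simp add: scale_scale mult_single)

definition edge :: "'g \<Rightarrow> 'g \<Rightarrow> 'm" where
  "edge u v = translate u 1 (\<kappa> (- u + v))"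

text \<open>The boundary of a triangle with vertices \<open>0\<close>, \<open>s\<close>,
  \<open>s + t\<close>: the failure of \<open>\<kappa>\<close> to be a crossed homomorphism.\<close>

definition defect :: "'g \<Rightarrow> 'g \<Rightarrow> 'm" where
  "defect s t = \<kappa> s + translate s 1 (\<kappa> t) - \<kappa> (s + t)"

definition triangle :: "'g \<Rightarrow> 'g \<Rightarrow> 'g \<Rightarrow> 'm" where
  "triangle u v w = edge u v + edge v w - edge u w"

lemma edge_refl [simp]: "edge u u = 0"
  by (simp add: edge_def \<kappa>_zero)

lemma triangle_eq: "triangle u v w = translate u 1 (defect (- u + v) (- v + w))"
proof -
  have "(- u + v) + (- v + w) = - u + w"
    by (simp add: add.assoc)
  moreover have "u + (- u + v) = v"
    by simp
  ultimately show ?thesis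
    by (simp add: triangle_def edge_def defect_def scale_right_distrib scale_diff_right
        translate_translate)
qed

text \<open>The coefficients \<open>w\<close> are arbitrary: the number of summands, and hence the
  discrete norm of a filling, is controlled by the size of \<open>H\<close> alone.\<close>

definition defect_span :: "nat \<Rightarrow> 'g set \<Rightarrow> 'm set" where
  "defect_span D H = range (\<lambda>w. \<Sum>(a, s, t)\<in>H \<times> {s. len s \<le> D} \<times> {t. len t \<le> D}.
     translate a (w (a, s, t)) (defect s t))"

lemma zero_in_defect_span: "0 \<in> defect_span D H"
  unfolding defect_span_def by (rule range_eqI[of _ _ "\<lambda>_. 0"]) (simp add: case_prod_unfold)

lemma diff_in_defect_span:
  assumes "x \<in> defect_span D H" "y \<in> defect_span D H"
  shows "x - y \<in> defect_span D H"
proof -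
  let ?I = "H \<times> {s. len s \<le> D} \<times> {t. len t \<le> D}"
  from assms obtain w w' where
    "x = (\<Sum>(a, s, t)\<in>?I. translate a (w (a, s, t)) (defect s t))"
    "y = (\<Sum>(a, s, t)\<in>?I. translate a (w' (a, s, t)) (defect s t))"
    unfolding defect_span_def by blast
  hence "x - y = (\<Sum>(a, s, t)\<in>?I. translate a (w (a, s, t) - w' (a, s, t)) (defect s t))"
    by (simp add: single_diff scale_diff_left sum_subtractf case_prod_unfold)
  thus ?thesis
    unfolding defect_span_def by (intro range_eqI[of _ _ "\<lambda>x. w x - w' x"]) simp
qed

lemma sum_in_defect_span:
  assumes "\<And>i. i \<in> A \<Longrightarrow> f i \<in> defect_span D H"
  shows "sum f A \<in> defect_span D H"
proof -
  have add: "x + y \<in> defect_span D H" if "x \<in> defect_span D H" "y \<in> defect_span D H" for x y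
    using diff_in_defect_span[OF that(1) diff_in_defect_span[OF zero_in_defect_span that(2)]] by simp
  show ?thesis
    using assms
    by (induction A rule: infinite_finite_induct) (auto intro: zero_in_defect_span add)
qed

lemma defect_in_defect_span:
  assumes "finite H" "a \<in> H" "len s \<le> D" "len t \<le> D"
  shows "translate a r (defect s t) \<in> defect_span D H"
proof -
  let ?I = "H \<times> {s. len s \<le> D} \<times> {t. len t \<le> D}"
  have "finite ?I" using assms(1) finite_ball by blast
  moreover have "(a, s, t) \<in> ?I" using assms by simp
  moreover have "(\<Sum>x\<in>?I. translate (fst x) (if x = (a, s, t) then r else 0) (defect (fst (snd x)) (snd (snd x))))
    = (\<Sum>x\<in>?I. if x = (a, s, t) then translate a r (defect s t) else 0)"
    by (rule sum.cong) auto
  ultimately have "(\<Sum>(a', s', t')\<in>?I. translate a' (if (a', s', t') = (a, s, t) then r else 0) (defect s' t'))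
    = translate a r (defect s t)"
    unfolding case_prod_unfold prod.collapse by simp
  thus ?thesis
    unfolding defect_span_def
    by (intro range_eqI[of _ _ "\<lambda>x. if x = (a, s, t) then r else 0"]) simp
qed

text \<open>The rungs telescope from a degenerate one at the bottom; each quadrilateral between
  consecutive rungs is cut into two triangles.\<close>

lemma ladder_sum:
  fixes p q :: "nat \<Rightarrow> 'g"
  assumes "p 0 = q 0"
  shows "edge (p J) (q J) =
    (\<Sum>j<J. triangle (p j) (p (Suc j)) (q (Suc j)) - triangle (p j) (q j) (q (Suc j))) +
    ((\<Sum>j<J. edge (q j) (q (Suc j))) - (\<Sum>j<J. edge (p j) (p (Suc j))))"
proof -
  have "(\<Sum>j<J. edge (p (Suc j)) (q (Suc j)) - edge (p j) (q j)) = edge (p J) (q J)"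
    using sum_lessThan_telescope[of "\<lambda>j. edge (p j) (q j)" J] assms by simp
  moreover have "edge (p (Suc j)) (q (Suc j)) - edge (p j) (q j) =
      triangle (p j) (p (Suc j)) (q (Suc j)) - triangle (p j) (q j) (q (Suc j)) +
      (edge (q j) (q (Suc j)) - edge (p j) (p (Suc j)))" for j
    by (simp add: triangle_def algebra_simps)
  ultimately show ?thesis
    by (simp add: sum.distrib sum_subtractf)
qed

section \<open>Components and the hull of a forest\<close>

lemma component_base:
  obtains b where "\<And>u. u \<in> V \<Longrightarrow> (u, b u) \<in> (steps l V)\<^sup>*"
    and "\<And>u v. (u, v) \<in> (steps l V)\<^sup>* \<Longrightarrow> b u = b v"
proof
  define b where "b u = (SOME w. (u, w) \<in> (steps l V)\<^sup>*)" for u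
  show "(u, b u) \<in> (steps l V)\<^sup>*" for u
    unfolding b_def by (rule someI[of _ u]) simp
  have "sym (steps l V)"
    using dst_commute by (auto simp: steps_def sym_def)
  hence "sym ((steps l V)\<^sup>*)" by (rule sym_rtrancl)
  hence "(u, w) \<in> (steps l V)\<^sup>* \<longleftrightarrow> (v, w) \<in> (steps l V)\<^sup>*" if "(u, v) \<in> (steps l V)\<^sup>*" for u v w
    using that by (meson rtrancl_trans symD)
  hence "(\<lambda>w. (u, w) \<in> (steps l V)\<^sup>*) = (\<lambda>w. (v, w) \<in> (steps l V)\<^sup>*)"
    if "(u, v) \<in> (steps l V)\<^sup>*" for u v
    using that by blast
  thus "b u = b v" if "(u, v) \<in> (steps l V)\<^sup>*" for u v
    unfolding b_def using that by (simp only:)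
qed

text \<open>\<open>card_tree_hull_le\<close> is applied to each component separately, with a chosen
  base point \<open>b u\<close> in the role of \<open>0\<close>.\<close>

lemma forest_hull:
  "\<exists>K. \<forall>V. finite V \<longrightarrow> (\<exists>b H. finite H \<and> card H \<le> K * card V \<and>
     (\<forall>u v. (u, v) \<in> steps l V \<longrightarrow> b u = b v) \<and>
     (\<forall>u\<in>V. \<forall>j. b u + anc j (- b u + u) \<in> H))"
proof -
  obtain K where K: "\<And>V. finite V \<Longrightarrow> \<forall>u\<in>V. (u, 0) \<in> (steps l V)\<^sup>* \<Longrightarrow>
      card (tree_hull V) \<le> K * card V"
    using card_tree_hull_le[of l] by blast
  show ?thesis
  proof (intro exI[of _ K] allI impI)
    fix V :: "'g set" assume V: "finite V"
    obtain b where b: "\<And>u. u \<in> V \<Longrightarrow> (u, b u) \<in> (steps l V)\<^sup>*"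
      "\<And>u v. (u, v) \<in> (steps l V)\<^sup>* \<Longrightarrow> b u = b v"
      using component_base[of V l] by metis
    define W where "W c = (\<lambda>u. - c + u) ` {u \<in> V. b u = c}" for c
    define H where "H = (\<Union>c\<in>b ` V. (+) c ` tree_hull (W c))"
    have finW: "finite (W c)" for c using V by (simp add: W_def)
    \<comment> \<open>Walks stay inside their component, and translation by the base point takes it
      to \<open>0\<close>.\<close>
    have walk: "\<forall>u\<in>W c. (u, 0) \<in> (steps l (W c))\<^sup>*" for c
    proof
      fix u' assume "u' \<in> W c"
      then obtain u where u: "u \<in> V" "b u = c" "u' = - c + u" by (auto simp: W_def)
      have "(- c + u, - c + w) \<in> (steps l (W c))\<^sup>*" if "(u, w) \<in> (steps l V)\<^sup>*" for w
        using that
      proof induction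
        case (step w w')
        have "b w = c" "b w' = c"
          using b(2)[OF step.hyps(1)] b(2)[OF rtrancl_into_rtrancl[OF step.hyps]] u(2) by auto
        hence "(- c + w, - c + w') \<in> steps l (W c)"
          using step.hyps(2) dst_left_invariant[of "- c" w w'] by (auto simp: steps_def W_def)
        with step.IH show ?case by (rule rtrancl_into_rtrancl)
      qed simp
      from this[OF b(1)[OF u(1)]] show "(u', 0) \<in> (steps l (W c))\<^sup>*"
        using u by simp
    qed
    have "card H \<le> (\<Sum>c\<in>b ` V. card ((+) c ` tree_hull (W c)))"
      unfolding H_def using V by (intro card_UN_le) simp
    also have "\<dots> \<le> (\<Sum>c\<in>b ` V. K * card {u \<in> V. b u = c})"
    proof (rule sum_mono)
      fix c
      have "card ((+) c ` tree_hull (W c)) \<le> card (tree_hull (W c))"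
        by (rule card_image_le[OF finite_tree_hull[OF finW]])
      also have "\<dots> \<le> K * card (W c)" by (rule K[OF finW walk])
      also have "\<dots> \<le> K * card {u \<in> V. b u = c}"
        unfolding W_def using V by (intro mult_le_mono2 card_image_le) simp
      finally show "card ((+) c ` tree_hull (W c)) \<le> K * card {u \<in> V. b u = c}" .
    qed
    \<comment> \<open>The fibres of \<open>b\<close> partition \<open>V\<close>.\<close>
    also have "\<dots> = K * card V"
      using sum.image_gen[OF V, of "\<lambda>_. 1 :: nat" b] by (simp flip: sum_distrib_left)
    finally have "card H \<le> K * card V" .
    moreover have "finite H"
      unfolding H_def using V finite_tree_hull[OF finW] by blast
    moreover have "b u + anc j (- b u + u) \<in> H" if "u \<in> V" for u j
      using that by (auto simp: H_def W_def tree_hull_def intro!: bexI[of _ u])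
    ultimately show "\<exists>b H. finite H \<and> card H \<le> K * card V \<and>
      (\<forall>u v. (u, v) \<in> steps l V \<longrightarrow> b u = b v) \<and> (\<forall>u\<in>V. \<forall>j. b u + anc j (- b u + u) \<in> H)"
      using b(2) by (intro exI[of _ b] exI[of _ H]) blast
  qed
qed

text \<open>The linear isoperimetric inequality in abstract form: both constants depend on
  \<open>l\<close> only, and the coefficients \<open>r\<close> do not enter the bound on
  \<open>H\<close>.\<close>

theorem cycle_in_defect_span:
  fixes l :: nat
  shows "\<exists>D K. \<forall>(E :: 'e set) src tgt r. finite E \<longrightarrow> (\<forall>e\<in>E. dst (src e) (tgt e) \<le> l) \<longrightarrow>
      (\<Sum>e\<in>E. Poly_Mapping.single (tgt e) (r e) - Poly_Mapping.single (src e) (r e)) = 0 \<longrightarrow>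
    (\<exists>H. finite H \<and> card H \<le> K * card E \<and>
      (\<Sum>e\<in>E. translate (src e) (r e) (\<kappa> (- src e + tgt e))) \<in> defect_span D H)"
proof -
  obtain D where D: "4 * \<delta> + 3 * real l \<le> real D" "D \<ge> 1"
  proof -
    obtain n where "4 * \<delta> + 3 * real l \<le> real n" using real_arch_simple by blast
    thus thesis by (intro that[of "n + 1"]) auto
  qed
  obtain K where K: "\<And>V. finite V \<Longrightarrow> \<exists>b H. finite H \<and> card H \<le> K * card V \<and>
     (\<forall>u v. (u, v) \<in> steps l V \<longrightarrow> b u = b v) \<and>
     (\<forall>u\<in>V. \<forall>j. b u + anc j (- b u + u) \<in> H)"
    using forest_hull[of l] by blast
  show ?thesis
  proof (rule exI[of _ D], rule exI[of _ "2 * K"], intro allI impI)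
    fix E :: "'e set" and src tgt :: "'e \<Rightarrow> 'g" and r :: "'e \<Rightarrow> 'r"
    assume E: "finite E" and short': "\<forall>e\<in>E. dst (src e) (tgt e) \<le> l"
      and cycle: "(\<Sum>e\<in>E. Poly_Mapping.single (tgt e) (r e) - Poly_Mapping.single (src e) (r e)) = 0"
    have short: "dst (src e) (tgt e) \<le> l" if "e \<in> E" for e
      using short' that by blast
    define V where "V = src ` E \<union> tgt ` E"
    have V: "finite V" using E by (simp add: V_def)
    obtain b H where bH: "finite H \<and> card H \<le> K * card V \<and>
        (\<forall>u v. (u, v) \<in> steps l V \<longrightarrow> b u = b v) \<and>
        (\<forall>u\<in>V. \<forall>j. b u + anc j (- b u + u) \<in> H)"
      using K[OF V] by (elim exE)
    from bH have H: "finite H" "card H \<le> K * card V" by auto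
    from bH have b: "b u = b v" if "(u, v) \<in> steps l V" for u v using that by auto
    from bH have inH: "b u + anc j (- b u + u) \<in> H" if "u \<in> V" for u j using that by auto
    define pt where "pt u j = b u + anc j (- b u + u)" for u j
    have pt0: "pt u 0 = b u" for u by (simp add: pt_def)
    have pt_step: "dst (pt u j) (pt u (Suc j)) \<le> 1" for u j
      unfolding pt_def dst_left_invariant by (rule dst_anc_Suc)
    \<comment> \<open>A common length for all paths: a path that arrives early rests at its
      endpoint, where its edges are degenerate.\<close>
    define J where "J = Max ((\<lambda>u. dst (b u) u) ` V)"
    have J: "dst (b u) u \<le> J" if "u \<in> V" for u
      unfolding J_def using V that by simp
    have ptJ: "pt u J = u" if "u \<in> V" for u
      using J[OF that] by (simp add: pt_def anc_above)
    define Q where "Q u = (\<Sum>j<J. edge (pt u j) (pt u (Suc j)))" for u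
    define filling where "filling e = (\<Sum>j<J.
      triangle (pt (src e) j) (pt (src e) (Suc j)) (pt (tgt e) (Suc j)) -
      triangle (pt (src e) j) (pt (tgt e) j) (pt (tgt e) (Suc j)))" for e
    have triangle_in: "translate 0 c (triangle u v w) \<in> defect_span D H"
      if "u \<in> H" "dst u v \<le> D" "dst v w \<le> D" for u v w c
      using defect_in_defect_span[OF H(1) that] by (simp add: triangle_eq translate_translate)
    have filling_in: "translate 0 (r e) (filling e) \<in> defect_span D H" if e: "e \<in> E" for e
    proof -
      have ends: "src e \<in> V" "tgt e \<in> V" using e by (auto simp: V_def)
      hence same: "b (src e) = b (tgt e)"
        using short[OF e] by (intro b) (simp add: steps_def)
      have rung: "dst (pt (src e) j) (pt (tgt e) j) \<le> D" for j
      proof -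
        have "dst (- b (src e) + src e) (- b (src e) + tgt e) \<le> l"
          using short[OF e] by (simp only: dst_left_invariant)
        from dst_anc_anc[OF this, of j] D(1)
        show ?thesis unfolding pt_def same[symmetric] dst_left_invariant by linarith
      qed
      \<comment> \<open>Both triangles of each quadrilateral start at \<open>pt (src e) j\<close>,
        so this is the translating element to be found in \<open>H\<close>.\<close>
      have "pt (src e) j \<in> H" for j unfolding pt_def by (rule inH[OF ends(1)])
      moreover have "dst (pt u j) (pt u (Suc j)) \<le> D" for u j
        using pt_step[of u j] D(2) by linarith
      ultimately show ?thesis
        unfolding filling_def scale_sum_right scale_diff_right
        by (intro sum_in_defect_span diff_in_defect_span triangle_in rung)
    qed
    have "translate (src e) (r e) (\<kappa> (- src e + tgt e)) = translate 0 (r e) (filling e) +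
        (translate 0 (r e) (Q (tgt e)) - translate 0 (r e) (Q (src e)))" if e: "e \<in> E" for e
    proof -
      have ends: "src e \<in> V" "tgt e \<in> V" using e by (auto simp: V_def)
      hence "b (src e) = b (tgt e)"
        using short[OF e] by (intro b) (simp add: steps_def)
      hence "edge (src e) (tgt e) = filling e + (Q (tgt e) - Q (src e))"
        using ladder_sum[of "pt (src e)" "pt (tgt e)" J] ptJ ends
        by (simp add: pt0 filling_def Q_def)
      moreover have "translate (src e) (r e) (\<kappa> (- src e + tgt e)) = translate 0 (r e) (edge (src e) (tgt e))"
        by (simp add: edge_def translate_translate)
      ultimately show ?thesis
        by (simp only: scale_right_distrib scale_diff_right)
    qed
    hence "(\<Sum>e\<in>E. translate (src e) (r e) (\<kappa> (- src e + tgt e))) =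
        (\<Sum>e\<in>E. translate 0 (r e) (filling e)) +
        (\<Sum>e\<in>E. translate 0 (r e) (Q (tgt e)) - translate 0 (r e) (Q (src e)))"
      unfolding sum.distrib[symmetric] by (rule sum.cong[OF refl])
    \<comment> \<open>This sum is the \<open>R\<close>-linear extension of \<open>Q\<close>,
      evaluated at the boundary of the cycle.\<close>
    also have "(\<Sum>e\<in>E. translate 0 (r e) (Q (tgt e)) - translate 0 (r e) (Q (src e))) = 0"
    proof -
      interpret R: lmodule "\<lambda>c. translate 0 c"
        using left_module_restrict by unfold_locales
      have "lin (translate 0) Q (\<Sum>e\<in>E. Poly_Mapping.single (tgt e) (r e) - Poly_Mapping.single (src e) (r e)) = 0"
        unfolding cycle by simp
      thus ?thesis
        by (simp add: R.lin_sum R.lin_diff)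
    qed
    finally have "(\<Sum>e\<in>E. translate (src e) (r e) (\<kappa> (- src e + tgt e))) \<in> defect_span D H"
      using sum_in_defect_span[of E] filling_in by simp
    \<comment> \<open>Each edge has two ends, hence the factor 2.\<close>
    moreover have "card V \<le> card E + card E"
      unfolding V_def using card_Un_le[of "src ` E" "tgt ` E"] card_image_le[OF E, of src]
        card_image_le[OF E, of tgt] by linarith
    hence "card H \<le> 2 * K * card E"
      using H(2) mult_le_mono2[of "card V" "card E + card E" K] by (simp add: algebra_simps)
    ultimately show "\<exists>H. finite H \<and> card H \<le> 2 * K * card E \<and>
      (\<Sum>e\<in>E. translate (src e) (r e) (\<kappa> (- src e + tgt e))) \<in> defect_span D H"
      using H(1) by blast
  qed
qed

end

section \<open>Comparison with the standard resolution\<close>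

text \<open>
  \<open>R\<close>-linearly, the element \<open>g [s]\<close> of the free \<open>RG\<close>-module on \<open>G\<close> is an edge from \<open>g\<close> to \<open>g + s\<close>.
\<close>

definition std_bdry :: "('g::group_add \<Rightarrow>\<^sub>0 ('g \<Rightarrow>\<^sub>0 'r::ring_1)) \<Rightarrow> ('g \<Rightarrow>\<^sub>0 'r)" where
  "std_bdry = lin (*) (\<lambda>s. Poly_Mapping.single s 1 - 1)"

lemma left_module_hom_std_bdry: "left_module_hom free_scale UNIV (*) UNIV std_bdry"
  unfolding std_bdry_def by (rule mult.left_module_hom_lin) auto

lemma left_module_hom_augmentation:
  "left_module_hom (*) UNIV trivial_scale UNIV augmentation"
  by (simp add: left_module_hom_def augmentation_add augmentation_mult trivial_scale_eq)

text \<open>Join every \<open>g\<close> in the support to \<open>0\<close> by a single edge; the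
  boundary of this star is \<open>a\<close> minus its augmentation placed at
  \<open>0\<close>.\<close>

lemma augmentation_eq_0_imp_std_bdry:
  fixes a :: "'g::group_add \<Rightarrow>\<^sub>0 'r::ring_1"
  assumes "augmentation a = 0"
  shows "a \<in> range std_bdry"
proof -
  let ?z = "\<Sum>g\<in>Poly_Mapping.keys a. Poly_Mapping.single g (Poly_Mapping.single 0 (Poly_Mapping.lookup a g))"
  have "std_bdry ?z = (\<Sum>g\<in>Poly_Mapping.keys a. Poly_Mapping.single g (Poly_Mapping.lookup a g)
      - Poly_Mapping.single 0 (Poly_Mapping.lookup a g))"
    by (simp add: std_bdry_def mult.lin_sum right_diff_distrib mult_single)
  also have "\<dots> = a - Poly_Mapping.single 0 (\<Sum>g\<in>Poly_Mapping.keys a. Poly_Mapping.lookup a g)"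
    using poly_mapping_eq_sum_single[of "Poly_Mapping.keys a" a, symmetric]
    by (simp add: sum_subtractf additive_sum[of "Poly_Mapping.single 0 :: 'r \<Rightarrow> 'g \<Rightarrow>\<^sub>0 'r", OF single_add])
  also have "(\<Sum>g\<in>Poly_Mapping.keys a. Poly_Mapping.lookup a g) = augmentation a"
    by (simp add: augmentation_def lin_def)
  finally have "std_bdry ?z = a" using assms by simp
  thus ?thesis by (rule range_eqI[OF sym])
qed

locale resolution =
  fixes X :: "('r::ring_1, 'g::group_add, 'm::ab_group_add) resolution"
  assumes resolution: "projective_resolution X"
begin

abbreviation "sc \<equiv> smul X"
abbreviation "C \<equiv> chains X"
abbreviation "d\<^sub>1 \<equiv> bdry X (Suc 0)"
abbreviation "d\<^sub>2 \<equiv> bdry X (Suc (Suc 0))"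

sublocale group_ring_module sc
  using resolution by unfold_locales (simp add: projective_resolution_def)

lemma submodule_chains: "submodule sc (C k)"
  and projective_chains: "projective sc (C k)"
  and bdry_hom: "left_module_hom sc (C (Suc k)) sc (C k) (bdry X (Suc k))"
  and aug_hom: "left_module_hom sc (C 0) trivial_scale UNIV (aug X)"
  and exact: "bdry X (Suc (Suc k)) ` C (Suc (Suc k)) = {x \<in> C (Suc k). bdry X (Suc k) x = 0}"
  and exact_0: "d\<^sub>1 ` C (Suc 0) = {x \<in> C 0. aug X x = 0}"
  and aug_surj: "aug X ` C 0 = UNIV"
  using resolution by (simp_all add: projective_resolution_def)

sublocale d1: lmodule_hom sc sc "C (Suc 0)" "C 0" d\<^sub>1
  using left_module submodule_chains bdry_hom by unfold_locales

sublocale d2: lmodule_hom sc sc "C (Suc (Suc 0))" "C (Suc 0)" d\<^sub>2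
  using left_module submodule_chains bdry_hom by unfold_locales

sublocale aug: lmodule_hom sc trivial_scale "C 0" UNIV "aug X"
  using left_module left_module_trivial_scale submodule_chains aug_hom by unfold_locales

lemma scale_closed: "x \<in> C k \<Longrightarrow> sc a x \<in> C k"
  and add_closed: "x \<in> C k \<Longrightarrow> y \<in> C k \<Longrightarrow> x + y \<in> C k"
  and zero_closed: "0 \<in> C k"
  using submodule_chains[of k] by (auto simp: submodule_def)

lemma diff_closed: "x \<in> C k \<Longrightarrow> y \<in> C k \<Longrightarrow> x - y \<in> C k"
  by (rule submodule_diff[OF submodule_chains])

text \<open>\<open>\<phi>\<close> and the linear extension of \<open>\<kappa>\<close> are chain maps
  in degree 1 to and from the standard complex, and \<open>h\<close> is the homotopy from the
  identity to their composite, restricted to cycles.\<close>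

lemma comparison:
  obtains \<kappa> :: "'g \<Rightarrow> 'm" and \<phi> :: "'m \<Rightarrow> 'g \<Rightarrow>\<^sub>0 'g \<Rightarrow>\<^sub>0 'r" and h :: "'m \<Rightarrow> 'm"
  where "\<kappa> 0 = 0" and "\<And>s. \<kappa> s \<in> C (Suc 0)"
    and "\<And>s t. d\<^sub>1 (\<kappa> s + sc (Poly_Mapping.single s 1) (\<kappa> t) - \<kappa> (s + t)) = 0"
    and "left_module_hom sc (C (Suc 0)) free_scale UNIV \<phi>"
    and "\<And>b. b \<in> C (Suc 0) \<Longrightarrow> d\<^sub>1 b = 0 \<Longrightarrow> std_bdry (\<phi> b) = 0"
    and "left_module_hom sc (C (Suc 0)) sc (C (Suc (Suc 0))) h"
    and "\<And>b. b \<in> C (Suc 0) \<Longrightarrow> d\<^sub>1 b = 0 \<Longrightarrow> d\<^sub>2 (h b) = lin sc \<kappa> (\<phi> b) - b"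
proof -
  \<comment> \<open>\<open>x\<close> is the image of the vertex \<open>0\<close> of the standard
    complex.\<close>
  have "1 \<in> aug X ` C 0" using aug_surj by simp
  then obtain x where x: "x \<in> C 0" "aug X x = 1" by auto
  have aug_scale_x: "aug X (sc a x) = augmentation a" for a
    using aug.scale[OF x(1)] x(2) by (simp add: trivial_scale_eq)

  have "\<exists>\<phi>. left_module_hom sc (C 0) (*) UNIV \<phi> \<and> (\<forall>c\<in>C 0. augmentation (\<phi> c :: 'g \<Rightarrow>\<^sub>0 'r) = aug X c)"
  proof (rule projective_lift)
    show "aug X ` C 0 \<subseteq> range (augmentation :: ('g \<Rightarrow>\<^sub>0 'r) \<Rightarrow> 'r)"
      using augmentation_single[of 0] by (metis rangeI subsetI)
  qed (rule left_module left_module_trivial_scale left_module_mult submodule_chains submodule_UNIV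
      projective_chains aug_hom left_module_hom_augmentation)+
  then obtain \<phi>0 :: "'m \<Rightarrow> 'g \<Rightarrow>\<^sub>0 'r" where \<phi>0: "left_module_hom sc (C 0) (*) UNIV \<phi>0"
    and aug_\<phi>0: "\<And>c. c \<in> C 0 \<Longrightarrow> augmentation (\<phi>0 c) = aug X c" by blast
  interpret \<phi>0: lmodule_hom sc "(*)" "C 0" UNIV \<phi>0
    using left_module left_module_mult submodule_chains \<phi>0 by unfold_locales

  have aug_d1: "aug X (d\<^sub>1 y) = 0" if "y \<in> C (Suc 0)" for y
    using exact_0 that by blast
  have hom_\<phi>0_d1: "left_module_hom sc (C (Suc 0)) (*) UNIV (\<lambda>y. \<phi>0 (d\<^sub>1 y))"
    by (simp add: left_module_hom_def d1.maps_to d1.add d1.scale \<phi>0.add \<phi>0.scale)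
  have "\<exists>\<phi>. left_module_hom sc (C (Suc 0)) free_scale UNIV \<phi> \<and>
      (\<forall>y\<in>C (Suc 0). std_bdry (\<phi> y) = \<phi>0 (d\<^sub>1 y))"
  proof (rule projective_lift)
    show "(\<lambda>y. \<phi>0 (d\<^sub>1 y)) ` C (Suc 0) \<subseteq> range std_bdry"
      using augmentation_eq_0_imp_std_bdry aug_\<phi>0[OF d1.maps_to] aug_d1 by auto
  qed (rule left_module left_module_free_scale left_module_mult submodule_chains submodule_UNIV
      projective_chains hom_\<phi>0_d1 left_module_hom_std_bdry)+
  then obtain \<phi> where \<phi>: "left_module_hom sc (C (Suc 0)) free_scale UNIV \<phi>"
    and bdry_\<phi>: "\<And>y. y \<in> C (Suc 0) \<Longrightarrow> std_bdry (\<phi> y) = \<phi>0 (d\<^sub>1 y)" by blast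
  interpret \<phi>: lmodule_hom sc free_scale "C (Suc 0)" UNIV \<phi>
    using left_module left_module_free_scale submodule_chains \<phi> by unfold_locales

  have "\<exists>y\<in>C (Suc 0). d\<^sub>1 y = sc (Poly_Mapping.single s 1 - 1) x" for s
  proof -
    have "aug X (sc (Poly_Mapping.single s 1 - 1) x) = 0"
      unfolding aug_scale_x by (simp add: augmentation_diff)
    hence "sc (Poly_Mapping.single s 1 - 1) x \<in> d\<^sub>1 ` C (Suc 0)"
      unfolding exact_0 using x by (simp add: scale_closed)
    thus ?thesis by auto
  qed
  then obtain \<kappa>' where \<kappa>': "\<And>s. \<kappa>' s \<in> C (Suc 0)"
    "\<And>s. d\<^sub>1 (\<kappa>' s) = sc (Poly_Mapping.single s 1 - 1) x" by metis
  \<comment> \<open>Resetting the value at \<open>0\<close> is harmless, since the required boundary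
    vanishes there.\<close>
  define \<kappa> where "\<kappa> s = (if s = 0 then 0 else \<kappa>' s)" for s
  have \<kappa>: "\<kappa> 0 = 0" "\<kappa> s \<in> C (Suc 0)" "d\<^sub>1 (\<kappa> s) = sc (Poly_Mapping.single s 1 - 1) x" for s
    using \<kappa>' by (auto simp: \<kappa>_def zero_closed)
  have d1_lin: "d\<^sub>1 (lin sc \<kappa> z) = sc (std_bdry z) x" for z
    by (simp add: d1.lin \<kappa> std_bdry_def) (simp add: lin_def scale_sum_left scale_scale)
  have lin_closed: "lin sc \<kappa> z \<in> C (Suc 0)" for z
    by (rule submodule_lin[OF submodule_chains]) (rule \<kappa>)

  \<comment> \<open>The homotopy in degree 0: the composite of the chain maps is
    \<open>sc (\<phi>0 c) x\<close>, which has the same augmentation as \<open>c\<close>.\<close>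
  have hom0: "left_module_hom sc (C 0) sc (C 0) (\<lambda>c. sc (\<phi>0 c) x - c)"
    using x by (auto simp: left_module_hom_def diff_closed scale_closed \<phi>0.add \<phi>0.scale
        scale_left_distrib scale_diff_right scale_scale)
  have "\<exists>h. left_module_hom sc (C 0) sc (C (Suc 0)) h \<and> (\<forall>c\<in>C 0. d\<^sub>1 (h c) = sc (\<phi>0 c) x - c)"
  proof (rule projective_lift)
    show "(\<lambda>c. sc (\<phi>0 c) x - c) ` C 0 \<subseteq> d\<^sub>1 ` C (Suc 0)"
      unfolding exact_0 using x
      by (auto simp: diff_closed scale_closed aug.diff aug_scale_x aug_\<phi>0)
  qed (rule left_module submodule_chains projective_chains bdry_hom hom0)+
  then obtain h0 where h0: "left_module_hom sc (C 0) sc (C (Suc 0)) h0"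
    and bdry_h0: "\<And>c. c \<in> C 0 \<Longrightarrow> d\<^sub>1 (h0 c) = sc (\<phi>0 c) x - c" by blast
  interpret h0: lmodule_hom sc sc "C 0" "C (Suc 0)" h0
    using left_module submodule_chains h0 by unfold_locales

  \<comment> \<open>Subtracting the degree-0 homotopy turns the difference into a cycle; on cycles
    the correction term vanishes.\<close>
  have hom1: "left_module_hom sc (C (Suc 0)) sc (C (Suc 0)) (\<lambda>y. lin sc \<kappa> (\<phi> y) - y - h0 (d\<^sub>1 y))"
    by (auto simp: left_module_hom_def diff_closed lin_closed h0.maps_to d1.maps_to d1.add d1.scale
        h0.add h0.scale \<phi>.add \<phi>.scale lin_add lin_free_scale scale_diff_right)
  have "\<exists>h. left_module_hom sc (C (Suc 0)) sc (C (Suc (Suc 0))) h \<and>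
      (\<forall>y\<in>C (Suc 0). d\<^sub>2 (h y) = lin sc \<kappa> (\<phi> y) - y - h0 (d\<^sub>1 y))"
  proof (rule projective_lift)
    show "(\<lambda>y. lin sc \<kappa> (\<phi> y) - y - h0 (d\<^sub>1 y)) ` C (Suc 0) \<subseteq> d\<^sub>2 ` C (Suc (Suc 0))"
      unfolding exact
      by (auto simp: diff_closed lin_closed h0.maps_to d1.maps_to d1.diff d1_lin bdry_\<phi> bdry_h0)
  qed (rule left_module submodule_chains projective_chains bdry_hom hom1)+
  then obtain h where h: "left_module_hom sc (C (Suc 0)) sc (C (Suc (Suc 0))) h"
    and bdry_h: "\<And>y. y \<in> C (Suc 0) \<Longrightarrow> d\<^sub>2 (h y) = lin sc \<kappa> (\<phi> y) - y - h0 (d\<^sub>1 y)" by blast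

  show thesis
  proof (rule that[of \<kappa> \<phi> h])
    show "\<kappa> 0 = 0" "\<And>s. \<kappa> s \<in> C (Suc 0)" by (fact \<kappa>)+
    show "left_module_hom sc (C (Suc 0)) free_scale UNIV \<phi>" by (fact \<phi>)
    show "left_module_hom sc (C (Suc 0)) sc (C (Suc (Suc 0))) h" by (fact h)
  next
    fix s t
    have "d\<^sub>1 (\<kappa> s + sc (Poly_Mapping.single s 1) (\<kappa> t) - \<kappa> (s + t)) =
        sc (Poly_Mapping.single s 1 - 1) x + sc (Poly_Mapping.single s 1) (sc (Poly_Mapping.single t 1 - 1) x)
        - sc (Poly_Mapping.single (s + t) 1 - 1) x"
      using \<kappa>(2) by (simp add: d1.add d1.diff d1.scale add_closed scale_closed \<kappa>(3))
    also have "\<dots> = 0"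
      by (simp add: scale_scale scale_diff_right mult_single scale_diff_left)
    finally show "d\<^sub>1 (\<kappa> s + sc (Poly_Mapping.single s 1) (\<kappa> t) - \<kappa> (s + t)) = 0" .
  next
    fix b assume b: "b \<in> C (Suc 0)" "d\<^sub>1 b = 0"
    show "std_bdry (\<phi> b) = 0" "d\<^sub>2 (h b) = lin sc \<kappa> (\<phi> b) - b"
      using b by (simp_all add: bdry_\<phi> bdry_h)
  qed
qed

end

section \<open>The linear upper bound\<close>

text \<open>Confines the edges occurring in all images under \<open>\<phi>\<close> to those of the
  images of basis elements.\<close>

lemma keys_lin_free_scale:
  "Poly_Mapping.keys (lin free_scale n a) \<subseteq> (\<Union>y\<in>Poly_Mapping.keys a. Poly_Mapping.keys (n y))"
proof
  fix k assume "k \<in> Poly_Mapping.keys (lin free_scale n a)"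
  hence "(\<Sum>y\<in>Poly_Mapping.keys a. Poly_Mapping.lookup a y * Poly_Mapping.lookup (n y) k) \<noteq> 0"
    by (simp add: lin_def in_keys_iff lookup_sum)
  then obtain y where "y \<in> Poly_Mapping.keys a" "Poly_Mapping.lookup a y * Poly_Mapping.lookup (n y) k \<noteq> 0"
    using sum.not_neutral_contains_not_neutral by blast
  thus "k \<in> (\<Union>y\<in>Poly_Mapping.keys a. Poly_Mapping.keys (n y))"
    by (auto simp: in_keys_iff intro!: bexI[of _ y])
qed

lemma std_bdry_eq_sum_supp:
  "std_bdry z = (\<Sum>(s, g)\<in>supp z.
    Poly_Mapping.single (g + s) (Poly_Mapping.lookup (Poly_Mapping.lookup z s) g) -
    Poly_Mapping.single g (Poly_Mapping.lookup (Poly_Mapping.lookup z s) g))"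
proof -
  interpret m: group_ring_module "(*) :: ('a \<Rightarrow>\<^sub>0 'b) \<Rightarrow> _" ..
  show ?thesis
    unfolding std_bdry_def m.lin_eq_sum_supp by (simp add: right_diff_distrib mult_single)
qed

text \<open>Move \<open>b\<close> to the standard complex, cone it off there, replace each defect by
  a fixed filling in degree 2, and correct by the homotopy \<open>h\<close>.\<close>

lemma linear_filling:
  fixes S :: "'g::group_add set" and X :: "('r::ring_1, 'g, 'm::ab_group_add) resolution"
  assumes "hyperbolic_generators S \<delta>" and "n_admissible 1 X B"
  shows "\<exists>K\<ge>0. \<forall>b\<in>bdry X (Suc 1) ` chains X (Suc 1). \<exists>c\<in>chains X (Suc 1). bdry X (Suc 1) c = b \<and>
    l1_norm (smul X) (B (Suc 1)) c \<le> K * l1_norm (smul X) (B 1) b"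
proof -
  interpret hyperbolic_generators S \<delta> by fact
  interpret resolution X
    using assms(2) by unfold_locales (simp add: n_admissible_def)
  interpret C1: based_module sc "C (Suc 0)" "B (Suc 0)"
    using assms(2) submodule_chains by unfold_locales (auto simp: n_admissible_def)
  interpret C2: based_module sc "C (Suc (Suc 0))" "B (Suc (Suc 0))"
    using assms(2) submodule_chains by unfold_locales (auto simp: n_admissible_def)
  let ?N1 = "l1_norm sc (B (Suc 0))" and ?N2 = "l1_norm sc (B (Suc (Suc 0)))"
  have finB: "finite (B (Suc 0))" using assms(2) by (simp add: n_admissible_def)
  obtain \<kappa> \<phi> h where \<kappa>: "\<kappa> 0 = 0" "\<And>s. \<kappa> s \<in> C (Suc 0)"
    and bdry_\<kappa>: "\<And>s t. d\<^sub>1 (\<kappa> s + sc (Poly_Mapping.single s 1) (\<kappa> t) - \<kappa> (s + t)) = 0"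
    and \<phi>: "left_module_hom sc (C (Suc 0)) free_scale UNIV \<phi>"
    and cycle: "\<And>b. b \<in> C (Suc 0) \<Longrightarrow> d\<^sub>1 b = 0 \<Longrightarrow> std_bdry (\<phi> b) = 0"
    and h: "left_module_hom sc (C (Suc 0)) sc (C (Suc (Suc 0))) h"
    and homotopy: "\<And>b. b \<in> C (Suc 0) \<Longrightarrow> d\<^sub>1 b = 0 \<Longrightarrow> d\<^sub>2 (h b) = lin sc \<kappa> (\<phi> b) - b"
    by (rule comparison) (rule that)
  interpret \<phi>: lmodule_hom sc free_scale "C (Suc 0)" UNIV \<phi>
    using left_module left_module_free_scale submodule_chains \<phi> by unfold_locales
  interpret h: lmodule_hom sc sc "C (Suc 0)" "C (Suc (Suc 0))" h
    using left_module submodule_chains h by unfold_locales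
  interpret cone S \<delta> sc \<kappa>
    using \<kappa>(1) by unfold_locales

  have "\<exists>c\<in>C (Suc (Suc 0)). d\<^sub>2 c = defect s t" for s t
  proof -
    have "defect s t \<in> d\<^sub>2 ` C (Suc (Suc 0))"
      unfolding exact using bdry_\<kappa>[of s t] \<kappa>(2)
      by (simp add: defect_def add_closed diff_closed scale_closed)
    thus ?thesis by auto
  qed
  then obtain \<tau> where \<tau>: "\<And>s t. \<tau> s t \<in> C (Suc (Suc 0))" "\<And>s t. d\<^sub>2 (\<tau> s t) = defect s t"
    by metis

  obtain K1 where K1: "K1 \<ge> 0" "\<And>b. b \<in> C (Suc 0) \<Longrightarrow> real (card (supp (\<phi> b))) \<le> K1 * ?N1 b"
    using C1.hom_bounded[OF left_module_free_scale submodule_UNIV subadditive_norm_supp \<phi> finB] by blast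
  obtain K2 where K2: "K2 \<ge> 0" "\<And>b. b \<in> C (Suc 0) \<Longrightarrow> ?N2 (h b) \<le> K2 * ?N1 b"
    using C1.hom_bounded[OF left_module submodule_chains C2.subadditive_l1_norm h finB] by blast

  define F where "F = (\<Union>y\<in>B (Suc 0). Poly_Mapping.keys (\<phi> y))"
  have keys_\<phi>: "Poly_Mapping.keys (\<phi> b) \<subseteq> F" if b: "b \<in> C (Suc 0)" for b
  proof -
    have keys: "Poly_Mapping.keys (C1.coords b) \<subseteq> B (Suc 0)"
      by (rule C1.keys_coords[OF b])
    have "B (Suc 0) \<subseteq> C (Suc 0)" using C1.basis by (simp add: free_basis_def)
    hence "\<phi> (lin sc id (C1.coords b)) = lin free_scale \<phi> (C1.coords b)"
      using keys by (subst \<phi>.lin) auto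
    hence "\<phi> b = lin free_scale \<phi> (C1.coords b)"
      using C1.lin_coords[OF b] by simp
    thus ?thesis
      using keys_lin_free_scale[of \<phi> "C1.coords b"] keys by (auto simp: F_def)
  qed
  \<comment> \<open>\<open>F\<close> is finite because the basis in degree 1 is, so edge lengths are
    bounded; the inserted \<open>0\<close> covers an empty \<open>F\<close>.\<close>
  define l where "l = Max (insert 0 (len ` F))"
  have l: "len s \<le> l" if "s \<in> F" for s
    unfolding l_def using that finB by (intro Max_ge) (auto simp: F_def)

  obtain D K where DK: "\<forall>(E :: ('g \<times> 'g) set) src tgt r. finite E \<longrightarrow> (\<forall>e\<in>E. dst (src e) (tgt e) \<le> l) \<longrightarrow>
      (\<Sum>e\<in>E. Poly_Mapping.single (tgt e) (r e) - Poly_Mapping.single (src e) (r e)) = 0 \<longrightarrow>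
    (\<exists>H. finite H \<and> card H \<le> K * card E \<and>
      (\<Sum>e\<in>E. translate (src e) (r e) (\<kappa> (- src e + tgt e))) \<in> defect_span D H)"
    using cycle_in_defect_span[of l] by (elim exE)
  let ?T = "{s. len s \<le> D} \<times> {t. len t \<le> D}"
  \<comment> \<open>The cost of one point of \<open>H\<close>: the total norm of all fillings based
    there.\<close>
  define T where "T = (\<Sum>(s, t)\<in>?T. ?N2 (\<tau> s t))"
  have N2_nonneg: "?N2 c \<ge> 0" for c by (simp add: C2.l1_norm_eq)
  have T: "T \<ge> 0" unfolding T_def by (intro sum_nonneg) (auto simp: N2_nonneg)

  show ?thesis
  proof (intro exI[of _ "K * K1 * T + K2"] conjI ballI)
    show "K * K1 * T + K2 \<ge> 0" using K1(1) K2(1) T by simp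
    fix b assume "b \<in> bdry X (Suc 1) ` chains X (Suc 1)"
    hence b: "b \<in> C (Suc 0)" "d\<^sub>1 b = 0" using exact[of 0] by auto
    define z where "z = \<phi> b"
    define r where "r e = Poly_Mapping.lookup (Poly_Mapping.lookup z (fst e)) (snd e)" for e
    have "\<exists>H. finite H \<and> card H \<le> K * card (supp z) \<and>
      (\<Sum>e\<in>supp z. translate (snd e) (r e) (\<kappa> (- snd e + (snd e + fst e)))) \<in> defect_span D H"
    proof (rule DK[rule_format])
      fix e assume "e \<in> supp z"
      hence "fst e \<in> F" using keys_\<phi>[OF b(1)] by (auto simp: supp_def z_def)
      thus "dst (snd e) (snd e + fst e) \<le> l"
        using l by simp
    next
      show "(\<Sum>e\<in>supp z. Poly_Mapping.single (snd e + fst e) (r e) - Poly_Mapping.single (snd e) (r e)) = 0"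
        using cycle[OF b] unfolding z_def[symmetric] std_bdry_eq_sum_supp
        by (simp add: case_prod_unfold r_def)
    qed simp
    then obtain H where H: "finite H" "card H \<le> K * card (supp z)"
      "(\<Sum>e\<in>supp z. translate (snd e) (r e) (\<kappa> (- snd e + (snd e + fst e)))) \<in> defect_span D H"
      by blast
    have "lin sc \<kappa> z \<in> defect_span D H"
      using H(3) unfolding lin_eq_sum_supp by (simp add: case_prod_unfold r_def)
    then obtain w where w: "lin sc \<kappa> z = (\<Sum>(a, s, t)\<in>H \<times> ?T. translate a (w (a, s, t)) (defect s t))"
      unfolding defect_span_def by blast
    define c where "c = (\<Sum>(a, s, t)\<in>H \<times> ?T. translate a (w (a, s, t)) (\<tau> s t))"
    have c: "c \<in> C (Suc (Suc 0))" "d\<^sub>2 c = lin sc \<kappa> z"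
      unfolding c_def w case_prod_unfold
      by (auto simp: d2.sum d2.scale \<tau> scale_closed intro: submodule_sum[OF submodule_chains])
    have "?N2 c \<le> (\<Sum>i\<in>H \<times> ?T. ?N2 (\<tau> (fst (snd i)) (snd (snd i))))"
      unfolding c_def case_prod_unfold
      by (rule subadditive_norm_sum[OF submodule_chains C2.subadditive_l1_norm]) (rule \<tau>)
    also have "\<dots> = (\<Sum>a\<in>H. T)"
      unfolding T_def by (simp only: case_prod_unfold sum.cartesian_product)
    also have "\<dots> = real (card H) * T" by simp
    also have "\<dots> \<le> real (K * card (supp z)) * T"
      using H(2) T by (intro mult_right_mono) (simp_all only: of_nat_le_iff)
    also have "\<dots> \<le> K * (K1 * ?N1 b) * T"
      using K1(2)[OF b(1)] T unfolding of_nat_mult z_def by (intro mult_right_mono mult_left_mono) auto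
    finally have N2_c: "?N2 c \<le> K * (K1 * ?N1 b) * T" .
    have hb: "h b \<in> C (Suc (Suc 0))" by (rule h.maps_to[OF b(1)])
    \<comment> \<open>A difference is written as a sum with a scalar multiple, to which
      subadditivity applies.\<close>
    have "c - h b = c + translate 0 (- 1) (h b)"
      using scale_minus_left[of 1 "h b"] by (simp add: single_uminus)
    moreover have "?N2 (c + translate 0 (- 1) (h b)) \<le> ?N2 c + ?N2 (translate 0 (- 1) (h b))"
      using C2.subadditive_l1_norm c(1) scale_closed[OF hb]
      by (simp add: subadditive_norm_def del: single_uminus)
    ultimately have "?N2 (c - h b) \<le> ?N2 c + ?N2 (translate 0 (- 1) (h b))"
      by (simp only:)
    also have "\<dots> \<le> ?N2 c + ?N2 (h b)"
      using C2.subadditive_l1_norm hb by (simp add: subadditive_norm_def)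
    also have "\<dots> \<le> (K * K1 * T + K2) * ?N1 b"
      using N2_c K2(2)[OF b(1)] by (simp add: algebra_simps)
    finally have "?N2 (c - h b) \<le> (K * K1 * T + K2) * ?N1 b" .
    moreover have "d\<^sub>2 (c - h b) = b"
      using c hb by (simp add: d2.diff homotopy[OF b] z_def)
    ultimately show "\<exists>c\<in>chains X (Suc 1). bdry X (Suc 1) c = b \<and>
        l1_norm (smul X) (B (Suc 1)) c \<le> (K * K1 * T + K2) * l1_norm (smul X) (B 1) b"
      using diff_closed[OF c(1) hb] by auto
  qed
qed

section \<open>Free modules on subsets of the index type\<close>

definition free_on :: "'i set \<Rightarrow> ('i \<Rightarrow>\<^sub>0 'a::ring_1) set" where
  "free_on J = {u. Poly_Mapping.keys u \<subseteq> J}"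

abbreviation unit_vec :: "'i \<Rightarrow> ('i \<Rightarrow>\<^sub>0 'a::ring_1)" where
  "unit_vec i \<equiv> Poly_Mapping.single i 1"

lemma submodule_free_on: "submodule free_scale (free_on J :: ('a \<Rightarrow>\<^sub>0 'b::ring_1) set)"
  unfolding submodule_def free_on_def
proof (intro conjI ballI allI CollectI)
  fix x y :: "'a \<Rightarrow>\<^sub>0 'b"
  assume "x \<in> {u. Poly_Mapping.keys u \<subseteq> J}" "y \<in> {u. Poly_Mapping.keys u \<subseteq> J}"
  thus "Poly_Mapping.keys (x + y) \<subseteq> J"
    using Poly_Mapping.keys_add[of x y] by blast
next
  fix a and x :: "'a \<Rightarrow>\<^sub>0 'b"
  assume "x \<in> {u. Poly_Mapping.keys u \<subseteq> J}"
  thus "Poly_Mapping.keys (free_scale a x) \<subseteq> J"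
    using keys_free_scale[of a x] by blast
qed simp

lemma unit_vec_in_free_on: "i \<in> J \<Longrightarrow> unit_vec i \<in> free_on J"
  by (simp add: free_on_def)

lemma (in lmodule) lin_lin: "lin scale n (lin free_scale f a) = lin scale (\<lambda>i. lin scale n (f i)) a"
  by (simp add: lin_def[of free_scale] lin_sum lin_free_scale) (simp add: lin_def)

lemma (in lmodule) hom_restrict:
  "left_module_hom scale' UNIV scale N f \<Longrightarrow> left_module_hom scale' M scale N f"
  by (auto simp: left_module_hom_def)

text \<open>The section sends each unit vector to the basis vector that it indexes; the retraction
  kills all indices outside the submodule, so that it lands in it.\<close>

lemma projective_free_on: "projective free_scale (free_on J :: ('i \<Rightarrow>\<^sub>0 'a::ring_1) set)"
proof -
  let ?M = "free_on J :: ('i \<Rightarrow>\<^sub>0 'a) set"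
  let ?s = "lin free_scale (\<lambda>i. unit_vec (unit_vec i)) :: ('i \<Rightarrow>\<^sub>0 'a) \<Rightarrow> (('i \<Rightarrow>\<^sub>0 'a) \<Rightarrow>\<^sub>0 'a)"
  let ?p = "lin free_scale (\<lambda>y. if y \<in> ?M then y else 0) :: (('i \<Rightarrow>\<^sub>0 'a) \<Rightarrow>\<^sub>0 'a) \<Rightarrow> _"
  have "left_module_hom free_scale ?M free_scale UNIV ?s"
    by (rule free.hom_restrict, rule free.left_module_hom_lin) auto
  moreover have "left_module_hom free_scale UNIV free_scale ?M ?p"
    by (intro free.left_module_hom_lin submodule_free_on)
      (use submodule_free_on[of J] in \<open>auto simp: submodule_def\<close>)
  moreover have "?p (?s x) = x" if "x \<in> ?M" for x
  proof -
    have "?p (?s x) = lin free_scale (\<lambda>i. if unit_vec i \<in> ?M then unit_vec i else 0) x"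
      by (simp add: free.lin_lin)
    also have "\<dots> = lin free_scale unit_vec x"
      by (rule free.lin_cong) (use that in \<open>auto simp: free_on_def\<close>)
    also have "\<dots> = x" by (rule lin_free_scale_single)
    finally show ?thesis .
  qed
  ultimately show ?thesis
    unfolding projective_def by (intro exI[of _ ?s] exI[of _ ?p] conjI ballI)
qed

text \<open>For uniqueness, apply the section \<open>?s\<close> to a representation
  \<open>a\<close>: on the basis vectors it returns their indices, and so recovers
  \<open>a\<close>.\<close>

lemma free_basis_free_on:
  "free_basis free_scale (free_on J :: ('i \<Rightarrow>\<^sub>0 'a::ring_1) set) (unit_vec ` J)"
proof -
  let ?s = "lin free_scale (\<lambda>i. unit_vec (unit_vec i)) :: ('i \<Rightarrow>\<^sub>0 'a) \<Rightarrow> (('i \<Rightarrow>\<^sub>0 'a) \<Rightarrow>\<^sub>0 'a)"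
  have represents_iff: "represents free_scale (unit_vec ` J) x a \<longleftrightarrow>
      Poly_Mapping.keys a \<subseteq> unit_vec ` J \<and> lin free_scale id a = x" for x :: "'i \<Rightarrow>\<^sub>0 'a" and a
    by (auto simp: represents_def lin_def)
  have "\<exists>!a. represents free_scale (unit_vec ` J) x a" if x: "x \<in> free_on J" for x :: "'i \<Rightarrow>\<^sub>0 'a"
  proof (rule ex1I[of _ "?s x"])
    have "Poly_Mapping.keys (?s x) \<subseteq> unit_vec ` J"
      using keys_lin_free_scale[of "\<lambda>i. unit_vec (unit_vec i)" x] x by (auto simp: free_on_def)
    moreover have "lin free_scale id (?s x) = x"
      by (simp add: free.lin_lin lin_free_scale_single)
    ultimately show "represents free_scale (unit_vec ` J) x (?s x)"
      by (simp add: represents_iff)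
  next
    fix a assume "represents free_scale (unit_vec ` J) x a"
    hence a: "Poly_Mapping.keys a \<subseteq> unit_vec ` J" "lin free_scale id a = x"
      by (simp_all add: represents_iff)
    have "?s x = lin free_scale (\<lambda>y. ?s y) a"
      unfolding a(2)[symmetric] free.lin_lin by simp
    also have "\<dots> = lin free_scale unit_vec a"
      by (rule free.lin_cong) (use a(1) in auto)
    finally show "a = ?s x" by (simp add: lin_free_scale_single)
  qed
  thus ?thesis
    by (auto simp: free_basis_def unit_vec_in_free_on)
qed

section \<open>A resolution inside the universe\<close>

text \<open>
  Each summand \<open>r g [(n, xs)]\<close> is coded as the entry \<open>(n, g, r)\<close>, followed by an entry holding the
  length of \<open>xs\<close> and then \<open>xs\<close> itself, so lists over \<open>\<nat> \<times> G \<times> R\<close> suffice as generators in all degrees.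
\<close>

function decode :: "(nat \<times> 'g \<times> 'r) list \<Rightarrow> ('r::ring_1, 'g::group_add) universe" where
  "decode ((n, g, r) # (m, _, _) # xs) =
     Poly_Mapping.single (n, take m xs) (Poly_Mapping.single g r) + decode (drop m xs)"
| "decode [] = 0"
| "decode [x] = 0"
  by pat_completeness auto
termination by (relation "measure length") auto

text \<open>The length entry makes codes self-delimiting, so the code of one summand can be put in
  front of the code of any other element.\<close>

lemma surj_decode: "surj (decode :: (nat \<times> 'g \<times> 'r) list \<Rightarrow> ('r::ring_1, 'g::group_add) universe)"
proof -
  have step: "Poly_Mapping.single i (Poly_Mapping.single g r) + u \<in> range decode"
    if u: "u \<in> range decode" for i and g :: 'g and r :: 'r and u :: "('r, 'g) universe"
  proof -
    obtain n xs where i: "i = (n, xs)" by fastforce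
    obtain ys where "u = decode ys" using u by blast
    hence "Poly_Mapping.single i (Poly_Mapping.single g r) + u =
        decode ((n, g, r) # (length xs, g, r) # xs @ ys)"
      by (simp add: i)
    thus ?thesis by blast
  qed
  have zero: "(0 :: ('r, 'g) universe) \<in> range decode"
    by (rule range_eqI[of _ _ "[]"]) simp
  have sum_in_range: "(\<Sum>x\<in>A. Poly_Mapping.single (i x) (Poly_Mapping.single (g x) (r x))) \<in> range decode"
    for A and i :: "_ \<Rightarrow> nat \<times> (nat \<times> 'g \<times> 'r) list" and g :: "_ \<Rightarrow> 'g" and r :: "_ \<Rightarrow> 'r"
    by (induction A rule: infinite_finite_induct) (simp_all add: zero step)
  show ?thesis
  proof (intro equalityI subsetI)
    fix u :: "('r, 'g) universe"
    interpret m: group_ring_module "free_scale :: ('g \<Rightarrow>\<^sub>0 'r) \<Rightarrow> ('r, 'g) universe \<Rightarrow> _" ..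
    have "lin free_scale unit_vec u = (\<Sum>x\<in>supp u. Poly_Mapping.single (fst x)
      (Poly_Mapping.single (snd x) (Poly_Mapping.lookup (Poly_Mapping.lookup u (fst x)) (snd x))))"
      unfolding m.lin_eq_sum_supp by (simp add: case_prod_unfold)
    hence "lin free_scale unit_vec u \<in> range decode"
      by (simp only: sum_in_range)
    thus "u \<in> range decode"
      unfolding lin_free_scale_single .
  qed simp
qed

definition encode :: "('r::ring_1, 'g::group_add) universe \<Rightarrow> (nat \<times> 'g \<times> 'r) list" where
  "encode = inv decode"

lemma decode_encode [simp]: "decode (encode u) = u"
  unfolding encode_def by (rule surj_f_inv_f[OF surj_decode])

text \<open>One map serves all degrees: the name of a generator is a code of its boundary.\<close>

definition univ_bdry :: "('r::ring_1, 'g::group_add) universe \<Rightarrow> ('r, 'g) universe" where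
  "univ_bdry = lin free_scale (\<lambda>i. decode (snd i))"

text \<open>\<open>(0, [])\<close> is the only generator in degree 0.\<close>

definition univ_aug :: "('r::ring_1, 'g::group_add) universe \<Rightarrow> 'r" where
  "univ_aug u = augmentation (Poly_Mapping.lookup u (0, []))"

lemma univ_bdry_unit_vec [simp]: "univ_bdry (unit_vec (k, encode x)) = x"
  by (simp add: univ_bdry_def)

text \<open>Degrees 1 and 2 are left open to be chosen finite; from degree 3 on, every code of a
  cycle is a generator.\<close>

fun generators :: "(nat \<times> 'g::group_add \<times> 'r::ring_1) list set \<Rightarrow> (nat \<times> 'g \<times> 'r) list set \<Rightarrow> nat \<Rightarrow>
    (nat \<times> 'g \<times> 'r) list set" where
  "generators I\<^sub>1 I\<^sub>2 0 = {[]}"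
| "generators I\<^sub>1 I\<^sub>2 (Suc 0) = I\<^sub>1"
| "generators I\<^sub>1 I\<^sub>2 (Suc (Suc 0)) = I\<^sub>2"
| "generators I\<^sub>1 I\<^sub>2 (Suc (Suc (Suc k))) = {l.
     decode l \<in> free_on ({Suc (Suc k)} \<times> generators I\<^sub>1 I\<^sub>2 (Suc (Suc k))) \<and> univ_bdry (decode l) = 0}"

definition univ_resolution ::
  "(nat \<times> 'g::group_add \<times> 'r::ring_1) list set \<Rightarrow> (nat \<times> 'g \<times> 'r) list set \<Rightarrow>
   ('r, 'g, ('r, 'g) universe) resolution" where
  "univ_resolution I\<^sub>1 I\<^sub>2 = \<lparr>smul = free_scale, chains = (\<lambda>k. free_on ({k} \<times> generators I\<^sub>1 I\<^sub>2 k)),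
     bdry = (\<lambda>_. univ_bdry), aug = univ_aug\<rparr>"

section \<open>The complex inside the universe and its exactness\<close>

lemma left_module_hom_univ_bdry: "left_module_hom free_scale UNIV free_scale UNIV univ_bdry"
  unfolding univ_bdry_def by (rule free.left_module_hom_lin) auto

interpretation univ_bdry: lmodule_hom free_scale free_scale UNIV UNIV univ_bdry
  using left_module_free_scale left_module_hom_univ_bdry by unfold_locales auto

lemma (in lmodule_hom) submodule_image: "submodule scale' (f ` M)"
  unfolding submodule_def
proof (intro conjI ballI allI)
  show "0 \<in> f ` M" using submodule zero by (metis image_eqI submodule_def)
  show "x + y \<in> f ` M" if "x \<in> f ` M" "y \<in> f ` M" for x y
    using that submodule by (auto simp: submodule_def simp flip: add)
  show "scale' a x \<in> f ` M" if "x \<in> f ` M" for a x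
    using that submodule by (auto simp: submodule_def simp flip: scale)
qed

lemma submodule_univ_bdry_image: "submodule free_scale (univ_bdry ` free_on J)"
proof -
  interpret lmodule_hom free_scale free_scale "free_on J" UNIV univ_bdry
    using left_module_free_scale free.hom_restrict[OF left_module_hom_univ_bdry] submodule_free_on
    by unfold_locales
  show ?thesis by (rule submodule_image)
qed

lemma univ_bdry_image_subset:
  assumes "submodule free_scale N" "\<And>k l. (k, l) \<in> J \<Longrightarrow> decode l \<in> N"
  shows "univ_bdry ` free_on J \<subseteq> N"
  unfolding univ_bdry_def using assms
  by (auto simp: free_on_def intro!: free.submodule_lin)

lemma submodule_kernel:
  "submodule free_scale {x \<in> free_on J. univ_bdry x = 0}"
  using submodule_free_on[of J] by (auto simp: submodule_def univ_bdry.add univ_bdry.scale)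

lemma univ_aug_add: "univ_aug (x + y) = univ_aug x + univ_aug y"
  and univ_aug_scale: "univ_aug (free_scale a x) = trivial_scale a (univ_aug x)"
  by (simp_all add: univ_aug_def lookup_add augmentation_add augmentation_mult trivial_scale_eq)

text \<open>Exactness has to be supplied at degrees 0 and 1 only: in higher degrees each cycle is
  the boundary of the generator that codes it.\<close>

lemma projective_resolution_univ:
  fixes I\<^sub>1 I\<^sub>2 :: "(nat \<times> 'g::group_add \<times> 'r::ring_1) list set"
  assumes exact0: "univ_bdry ` free_on ({Suc 0} \<times> I\<^sub>1) = {x \<in> free_on {(0, [])}. univ_aug x = 0}"
    and exact1: "univ_bdry ` free_on ({2} \<times> I\<^sub>2) = {x \<in> free_on ({Suc 0} \<times> I\<^sub>1). univ_bdry x = 0}"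
  shows "projective_resolution (univ_resolution I\<^sub>1 I\<^sub>2)"
proof -
  let ?C = "\<lambda>k. free_on ({k} \<times> generators I\<^sub>1 I\<^sub>2 k) :: ('r, 'g) universe set"
  have exact: "univ_bdry ` ?C (Suc (Suc k)) = {x \<in> ?C (Suc k). univ_bdry x = 0}" for k
  proof (cases k)
    case 0
    thus ?thesis using exact1 by (simp add: numeral_2_eq_2)
  next
    case (Suc n)
    show ?thesis
    proof (intro equalityI subsetI)
      fix x assume "x \<in> univ_bdry ` ?C (Suc (Suc k))"
      moreover have "univ_bdry ` ?C (Suc (Suc k)) \<subseteq> {x \<in> ?C (Suc k). univ_bdry x = 0}"
        by (rule univ_bdry_image_subset[OF submodule_kernel]) (auto simp: Suc)
      ultimately show "x \<in> {x \<in> ?C (Suc k). univ_bdry x = 0}" by blast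
    next
      fix x assume "x \<in> {x \<in> ?C (Suc k). univ_bdry x = 0}"
      hence "unit_vec (Suc (Suc k), encode x) \<in> ?C (Suc (Suc k))"
        by (intro unit_vec_in_free_on) (simp add: Suc)
      moreover have "x = univ_bdry (unit_vec (Suc (Suc k), encode x))" by simp
      ultimately show "x \<in> univ_bdry ` ?C (Suc (Suc k))" by (rule rev_image_eqI)
    qed
  qed
  have exact0': "univ_bdry ` ?C (Suc 0) = {x \<in> ?C 0. univ_aug x = 0}"
    using exact0 by simp
  have "univ_bdry ` ?C (Suc k) \<subseteq> ?C k" for k
    using exact exact0' by (cases k) blast+
  hence "left_module_hom free_scale (?C (Suc k)) free_scale (?C k) univ_bdry" for k
    using left_module_hom_univ_bdry by (auto simp: left_module_hom_def)
  moreover have "univ_aug ` ?C 0 = UNIV"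
  proof (intro equalityI subsetI)
    fix r :: 'r
    have "Poly_Mapping.single (0, []) (Poly_Mapping.single 0 r) \<in> ?C 0"
      by (auto simp: free_on_def)
    moreover have "r = univ_aug (Poly_Mapping.single (0, []) (Poly_Mapping.single 0 r) :: ('r, 'g) universe)"
      by (simp add: univ_aug_def)
    ultimately show "r \<in> univ_aug ` ?C 0" by (rule rev_image_eqI)
  qed simp
  moreover have "left_module_hom free_scale (?C 0) trivial_scale UNIV univ_aug"
    by (simp add: left_module_hom_def univ_aug_add univ_aug_scale)
  ultimately show ?thesis
    unfolding projective_resolution_def univ_resolution_def
    using exact exact0'
    by (simp add: submodule_free_on projective_free_on left_module_free_scale del: generators.simps)
qed

text \<open>Degree 1 is the Cayley graph and degree 2 is generated by the defects in a ball. The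
  cone construction for \<open>l = 1\<close> shows that these fill all cycles.\<close>

lemma admissible_resolution_exists:
  fixes S :: "'g::group_add set"
  assumes "hyperbolic_generators S \<delta>"
  shows "\<exists>(X :: ('r::ring_1, 'g, ('r, 'g) universe) resolution) B. n_admissible 1 X B"
proof -
  interpret hyperbolic_generators S \<delta> by fact
  define v where "v s = free_scale (Poly_Mapping.single s 1 - 1) (unit_vec (0, []) :: ('r, 'g) universe)" for s
  define I\<^sub>1 where "I\<^sub>1 = encode ` v ` {s. len s = 1}"
  let ?M0 = "free_on {(0, [])} :: ('r, 'g) universe set"
  let ?M1 = "free_on ({Suc 0} \<times> I\<^sub>1) :: ('r, 'g) universe set"
  have fin1: "finite I\<^sub>1"
    unfolding I\<^sub>1_def by (intro finite_imageI finite_subset[OF _ finite_ball[of 1]]) auto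
  have v0: "v s \<in> ?M0" "univ_aug (v s) = 0" for s
    by (auto simp: v_def free_on_def univ_aug_def augmentation_diff)
  \<comment> \<open>Split off the last letter: \<open>s - 1\<close> is
    \<open>h (t - 1) + (h - 1)\<close> in the group ring, with \<open>t\<close> of length 1.\<close>
  have im1: "v s \<in> univ_bdry ` ?M1" for s
  proof (induction "len s" arbitrary: s)
    case 0
    hence "s = 0" by simp
    hence "v s = 0" by (simp add: v_def)
    thus ?case using submodule_univ_bdry_image[of "{Suc 0} \<times> I\<^sub>1"] by (simp add: submodule_def)
  next
    case (Suc n)
    then obtain h where h: "len h = n" "dst h s = 1"
      using predecessor_exists[of s n] by auto
    define t where "t = - h + s"
    have s: "s = h + t" by (simp add: t_def add.assoc[symmetric])
    have "unit_vec (Suc 0, encode (v t)) \<in> ?M1"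
      using h(2) by (intro unit_vec_in_free_on) (auto simp: I\<^sub>1_def t_def)
    hence "v t \<in> univ_bdry ` ?M1"
      by (rule rev_image_eqI) simp
    hence "free_scale (Poly_Mapping.single h 1) (v t) + v h \<in> univ_bdry ` ?M1"
      using Suc.hyps(1)[of h] h(1) submodule_univ_bdry_image[of "{Suc 0} \<times> I\<^sub>1"]
      unfolding submodule_def by blast
    moreover have "v s = free_scale (Poly_Mapping.single h 1) (v t) + v h"
      unfolding v_def s by (simp add: right_diff_distrib mult_single flip: single_add)
    ultimately show ?case by simp
  qed
  have submodule_aug: "submodule free_scale {x \<in> ?M0. univ_aug x = 0}"
    using submodule_free_on[of "{(0, [])}"]
    by (auto simp: submodule_def univ_aug_add univ_aug_scale trivial_scale_eq)
      (simp add: univ_aug_def)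
  have exact0: "univ_bdry ` ?M1 = {x \<in> ?M0. univ_aug x = 0}"
  proof
    show "univ_bdry ` ?M1 \<subseteq> {x \<in> ?M0. univ_aug x = 0}"
      by (rule univ_bdry_image_subset[OF submodule_aug]) (auto simp: I\<^sub>1_def v0)
    show "{x \<in> ?M0. univ_aug x = 0} \<subseteq> univ_bdry ` ?M1"
    proof
      fix x assume x: "x \<in> {x \<in> ?M0. univ_aug x = 0}"
      define a where "a = Poly_Mapping.lookup x (0, [])"
      have "a \<in> range std_bdry"
        using x by (intro augmentation_eq_0_imp_std_bdry) (simp add: a_def univ_aug_def)
      then obtain z where z: "a = std_bdry z" by blast
      have "x = free_scale a (unit_vec (0, []))"
        using x poly_mapping_eq_sum_single[of "{(0, [])}" x] by (simp add: free_on_def a_def)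
      also have "\<dots> = lin free_scale v z"
        by (simp add: z std_bdry_def lin_def v_def free.scale_sum_left free.scale_scale
            del: free_scale_single)
      finally show "x \<in> univ_bdry ` ?M1"
        using free.submodule_lin[where a = z and n = v, OF submodule_univ_bdry_image im1] by simp
    qed
  qed
  have "\<exists>y\<in>?M1. univ_bdry y = v s" for s
    using im1[of s] by auto
  then obtain \<kappa>' where \<kappa>': "\<And>s. \<kappa>' s \<in> ?M1" "\<And>s. univ_bdry (\<kappa>' s) = v s" by metis
  \<comment> \<open>On elements of length 1, \<open>\<kappa>\<close> has to be the basis edge
    itself, so that the sum over the edges of a cycle is that cycle; the other values are arbitrary
    lifts.\<close>
  define \<kappa> where "\<kappa> s = (if s = 0 then 0 else if len s = 1 then unit_vec (Suc 0, encode (v s)) else \<kappa>' s)" for s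
  have \<kappa>: "\<kappa> s \<in> ?M1" "univ_bdry (\<kappa> s) = v s" for s
  proof -
    have "unit_vec (Suc 0, encode (v s)) \<in> ?M1" if "len s = 1"
      using that by (intro unit_vec_in_free_on) (auto simp: I\<^sub>1_def)
    moreover have "0 \<in> ?M1"
      by (simp add: free_on_def)
    ultimately show "\<kappa> s \<in> ?M1" using \<kappa>'(1) by (simp add: \<kappa>_def)
    have "v 0 = 0" by (simp add: v_def)
    thus "univ_bdry (\<kappa> s) = v s" using \<kappa>'(2) by (simp add: \<kappa>_def)
  qed
  interpret cone S \<delta> "free_scale :: ('g \<Rightarrow>\<^sub>0 'r) \<Rightarrow> ('r, 'g) universe \<Rightarrow> _" \<kappa>
    by unfold_locales (simp add: \<kappa>_def)
  obtain D K where DK: "\<forall>(E :: ((nat \<times> (nat \<times> 'g \<times> 'r) list) \<times> 'g) set) src tgt r. finite E \<longrightarrow>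
      (\<forall>e\<in>E. dst (src e) (tgt e) \<le> 1) \<longrightarrow>
      (\<Sum>e\<in>E. Poly_Mapping.single (tgt e) (r e) - Poly_Mapping.single (src e) (r e)) = 0 \<longrightarrow>
    (\<exists>H. finite H \<and> card H \<le> K * card E \<and>
      (\<Sum>e\<in>E. translate (src e) (r e) (\<kappa> (- src e + tgt e))) \<in> defect_span D H)"
    using cycle_in_defect_span[of 1] by (elim exE)
  define I\<^sub>2 where "I\<^sub>2 = (\<lambda>(s, t). encode (defect s t)) ` ({s. len s \<le> D} \<times> {t. len t \<le> D})"
  let ?M2 = "free_on ({2} \<times> I\<^sub>2) :: ('r, 'g) universe set"
  have fin2: "finite I\<^sub>2"
    unfolding I\<^sub>2_def using finite_ball by blast
  have defect: "defect s t \<in> ?M1" "univ_bdry (defect s t) = 0" for s t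
  proof -
    show "defect s t \<in> ?M1"
      unfolding defect_def using \<kappa>(1) submodule_free_on[of "{Suc 0} \<times> I\<^sub>1"]
      by (intro free.submodule_diff) (auto simp: submodule_def)
    show "univ_bdry (defect s t) = 0"
      unfolding defect_def
      by (simp add: univ_bdry.add univ_bdry.diff univ_bdry.scale \<kappa>(2))
        (simp add: v_def right_diff_distrib mult_single flip: single_add single_diff)
  qed
  have exact1: "univ_bdry ` ?M2 = {x \<in> ?M1. univ_bdry x = 0}"
  proof
    show "univ_bdry ` ?M2 \<subseteq> {x \<in> ?M1. univ_bdry x = 0}"
      by (rule univ_bdry_image_subset[OF submodule_kernel]) (auto simp: I\<^sub>2_def defect)
    show "{x \<in> ?M1. univ_bdry x = 0} \<subseteq> univ_bdry ` ?M2"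
    proof
      fix z assume "z \<in> {x \<in> ?M1. univ_bdry x = 0}"
      hence z: "Poly_Mapping.keys z \<subseteq> {Suc 0} \<times> I\<^sub>1" "univ_bdry z = 0" by (auto simp: free_on_def)
      have "\<exists>s. len s = 1 \<and> i = (Suc 0, encode (v s))" if "i \<in> {Suc 0} \<times> I\<^sub>1" for i
        using that by (auto simp: I\<^sub>1_def)
      then obtain \<sigma> where \<sigma>: "\<And>i. i \<in> {Suc 0} \<times> I\<^sub>1 \<Longrightarrow> len (\<sigma> i) = 1"
        "\<And>i. i \<in> {Suc 0} \<times> I\<^sub>1 \<Longrightarrow> i = (Suc 0, encode (v (\<sigma> i)))" by metis
      define r where "r e = Poly_Mapping.lookup (Poly_Mapping.lookup z (fst e)) (snd e)" for e
      have \<sigma>': "len (\<sigma> (fst e)) = 1" "fst e = (Suc 0, encode (v (\<sigma> (fst e))))" if "e \<in> supp z" for e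
        using \<sigma>[of "fst e"] that z(1) by (auto simp: supp_def)
      have "0 = univ_bdry z" using z(2) by simp
      also have "\<dots> = (\<Sum>e\<in>supp z. translate (snd e) (r e) (decode (snd (fst e))))"
        unfolding univ_bdry_def lin_eq_sum_supp by (simp add: case_prod_unfold r_def)
      also have "\<dots> = (\<Sum>e\<in>supp z. Poly_Mapping.single (0, [])
          (Poly_Mapping.single (snd e + \<sigma> (fst e)) (r e) - Poly_Mapping.single (snd e) (r e)))"
      proof (rule sum.cong[OF refl])
        fix e assume "e \<in> supp z"
        hence "snd (fst e) = encode (v (\<sigma> (fst e)))" using \<sigma>'(2) by (metis snd_conv)
        thus "translate (snd e) (r e) (decode (snd (fst e))) = Poly_Mapping.single (0, [])
          (Poly_Mapping.single (snd e + \<sigma> (fst e)) (r e) - Poly_Mapping.single (snd e) (r e))"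
          by (simp add: v_def right_diff_distrib mult_single)
      qed
      finally have "(\<Sum>e\<in>supp z. Poly_Mapping.single (0, []) (Poly_Mapping.single (snd e + \<sigma> (fst e)) (r e)
          - Poly_Mapping.single (snd e) (r e))) = (0 :: ('r, 'g) universe)" ..
      \<comment> \<open>Reading off the coordinate at \<open>(0, [])\<close> turns the vanishing
        boundary into the cycle condition in the group ring.\<close>
      from arg_cong[OF this, of "\<lambda>u. Poly_Mapping.lookup u (0, [])"]
      have cycle: "(\<Sum>e\<in>supp z. Poly_Mapping.single (snd e + \<sigma> (fst e)) (r e)
          - Poly_Mapping.single (snd e) (r e)) = 0"
        by (simp add: lookup_sum)
      have "\<exists>H. finite H \<and> card H \<le> K * card (supp z) \<and> (\<Sum>e\<in>supp z.
          translate (snd e) (r e) (\<kappa> (- snd e + (snd e + \<sigma> (fst e))))) \<in> defect_span D H"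
        by (rule DK[rule_format]) (use \<sigma>'(1) cycle in auto)
      moreover have "(\<Sum>e\<in>supp z. translate (snd e) (r e) (\<kappa> (- snd e + (snd e + \<sigma> (fst e))))) = z"
      proof -
        have "\<kappa> (\<sigma> (fst e)) = unit_vec (fst e)" if "e \<in> supp z" for e
          using \<sigma>'[OF that] by (auto simp: \<kappa>_def)
        hence "(\<Sum>e\<in>supp z. translate (snd e) (r e) (\<kappa> (- snd e + (snd e + \<sigma> (fst e))))) =
            (\<Sum>e\<in>supp z. translate (snd e) (r e) (unit_vec (fst e)))"
          by (intro sum.cong refl) simp
        also have "\<dots> = lin free_scale unit_vec z"
          unfolding lin_eq_sum_supp by (simp add: case_prod_unfold r_def)
        finally show ?thesis by (simp add: lin_free_scale_single)
      qed
      ultimately obtain H where "z \<in> defect_span D H" by auto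
      then obtain w where w: "z = (\<Sum>(a, s, t)\<in>H \<times> {s. len s \<le> D} \<times> {t. len t \<le> D}.
          translate a (w (a, s, t)) (defect s t))"
        unfolding defect_span_def by blast
      \<comment> \<open>Each defect in the ball is the boundary of the generator of
        \<open>?M2\<close> that codes it.\<close>
      have "defect s t \<in> univ_bdry ` ?M2" if "len s \<le> D" "len t \<le> D" for s t
      proof -
        have "unit_vec (2, encode (defect s t)) \<in> ?M2"
          using that by (intro unit_vec_in_free_on) (auto simp: I\<^sub>2_def)
        thus ?thesis by (rule rev_image_eqI) simp
      qed
      hence "translate a r (defect s t) \<in> univ_bdry ` ?M2" if "len s \<le> D" "len t \<le> D" for a r s t
        using submodule_univ_bdry_image[of "{2} \<times> I\<^sub>2"] that unfolding submodule_def by blast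
      thus "z \<in> univ_bdry ` ?M2"
        unfolding w by (intro free.submodule_sum[OF submodule_univ_bdry_image]) auto
    qed
  qed
  have "n_admissible 1 (univ_resolution I\<^sub>1 I\<^sub>2) (\<lambda>k. unit_vec ` ({k} \<times> generators I\<^sub>1 I\<^sub>2 k))"
    unfolding n_admissible_def
    using projective_resolution_univ[OF exact0 exact1] fin1 fin2
    by (auto simp: univ_resolution_def intro: free_basis_free_on)
  thus ?thesis by blast
qed

section \<open>Linear growth\<close>

text \<open>Only the upper bound carries content: the term \<open>K * x + C\<close> in the
  definition of domination already gives the other direction.\<close>

lemma linear_class_iff:
  "f \<in> linear_class \<longleftrightarrow> (\<exists>C>0. \<exists>K>0. \<forall>x\<ge>0. f x \<le> ennreal (K * x + C))"
proof
  assume "f \<in> linear_class"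
  then obtain C K where CK: "C > 0" "K > 0"
    "\<And>x. x \<ge> 0 \<Longrightarrow> f x \<le> ennreal K * ennreal (K * x + C) + ennreal (K * x + C)"
    by (auto simp: linear_class_def equivalent_growth_def dominated_def)
  have "f x \<le> ennreal ((K * K + K) * x + (K * C + C))" if "x \<ge> 0" for x
    using CK(3)[OF that] that CK(1,2)
    by (simp add: ennreal_mult[symmetric] ennreal_plus[symmetric] algebra_simps del: ennreal_plus)
  moreover have "K * K + K > 0" "K * C + C > 0" using CK by (simp_all add: add_pos_pos)
  ultimately show "\<exists>C>0. \<exists>K>0. \<forall>x\<ge>0. f x \<le> ennreal (K * x + C)" by blast
next
  assume "\<exists>C>0. \<exists>K>0. \<forall>x\<ge>0. f x \<le> ennreal (K * x + C)"
  hence "f \<preceq>\<^sub>F ennreal"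
    unfolding dominated_def by (meson add_increasing order.trans order_refl zero_le)
  moreover have "ennreal \<preceq>\<^sub>F f"
    unfolding dominated_def
    by (intro exI[of _ 1] conjI allI impI) (auto intro!: add_increasing ennreal_leI)
  ultimately show "f \<in> linear_class"
    by (simp add: linear_class_def equivalent_growth_def)
qed

text \<open>For the same reason the linear class lies below every function.\<close>

lemma linear_dominated:
  assumes "f \<in> linear_class"
  shows "f \<preceq>\<^sub>F g"
  using assms unfolding linear_class_iff dominated_def
  by (meson add_increasing order.trans order_refl zero_le)

lemma dominated_linear:
  assumes "f \<preceq>\<^sub>F g" "g \<in> linear_class"
  shows "f \<in> linear_class"
proof -
  obtain C K where CK: "C > 0" "K > 0"
    "\<And>x. x \<ge> 0 \<Longrightarrow> f x \<le> ennreal K * g (K * x + C) + ennreal (K * x + C)"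
    using assms(1) unfolding dominated_def by blast
  obtain C' K' where CK': "C' > 0" "K' > 0" "\<And>x. x \<ge> 0 \<Longrightarrow> g x \<le> ennreal (K' * x + C')"
    using assms(2) unfolding linear_class_iff by blast
  have "f x \<le> ennreal ((K * K' * K + K) * x + (K * (K' * C + C') + C))" if x: "x \<ge> 0" for x
  proof -
    have nonneg: "K * x + C \<ge> 0" "K' * (K * x + C) + C' \<ge> 0"
      using CK(1,2) CK'(1,2) x by simp_all
    have "f x \<le> ennreal K * g (K * x + C) + ennreal (K * x + C)" by (rule CK(3)[OF x])
    also have "\<dots> \<le> ennreal K * ennreal (K' * (K * x + C) + C') + ennreal (K * x + C)"
      by (intro add_right_mono mult_left_mono CK'(3) nonneg) simp
    also have "\<dots> = ennreal (K * (K' * (K * x + C) + C') + (K * x + C))"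
      using nonneg CK(2) by (simp add: ennreal_mult ennreal_plus)
    also have "K * (K' * (K * x + C) + C') + (K * x + C)
        = (K * K' * K + K) * x + (K * (K' * C + C') + C)" by (simp add: algebra_simps)
    finally show ?thesis .
  qed
  moreover have "K * K' * K + K > 0" "K * (K' * C + C') + C > 0"
    using CK CK' by (simp_all add: add_pos_pos)
  ultimately show ?thesis
    unfolding linear_class_iff by blast
qed

lemma isoperimetric_function_linear:
  fixes X :: "('r::ring_1, 'g::group_add, 'm::ab_group_add) resolution"
  assumes "hyperbolic_group TYPE('g)" and adm: "n_admissible 1 X B"
  shows "isoperimetric_function 1 X B \<in> linear_class"
proof -
  obtain S \<delta> where "hyperbolic_generators (S :: 'g set) \<delta>"
    using assms(1) unfolding hyperbolic_group_def gromov_hyperbolic_def hyperbolic_generators_def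
    by blast
  from linear_filling[OF this adm] obtain K where K: "K \<ge> 0"
    "\<And>b. b \<in> bdry X (Suc 1) ` chains X (Suc 1) \<Longrightarrow> \<exists>c\<in>chains X (Suc 1). bdry X (Suc 1) c = b \<and>
      l1_norm (smul X) (B (Suc 1)) c \<le> K * l1_norm (smul X) (B 1) b" by blast
  \<comment> \<open>\<open>K\<close> may be \<open>0\<close>, but the slope and the constant have to
    be positive.\<close>
  have "isoperimetric_function 1 X B l \<le> ennreal ((K + 1) * l + 1)" if l: "l \<ge> 0" for l
    unfolding isoperimetric_function_def
  proof (rule SUP_least)
    fix b assume b: "b \<in> {b \<in> bdry X (Suc 1) ` chains X (Suc 1). l1_norm (smul X) (B 1) b \<le> l}"
    then obtain c where c: "c \<in> chains X (Suc 1)" "bdry X (Suc 1) c = b"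
      "l1_norm (smul X) (B (Suc 1)) c \<le> K * l1_norm (smul X) (B 1) b"
      using K(2)[of b] by blast
    have "K * l1_norm (smul X) (B 1) b \<le> K * l"
      using b K(1) by (intro mult_left_mono) auto
    also have "\<dots> \<le> (K + 1) * l + 1" using l by (simp add: algebra_simps)
    finally have "l1_norm (smul X) (B (Suc 1)) c \<le> (K + 1) * l + 1"
      using c(3) by simp
    thus "(INF c\<in>{c \<in> chains X (Suc 1). bdry X (Suc 1) c = b}.
        ennreal (l1_norm (smul X) (B (Suc 1)) c)) \<le> ennreal ((K + 1) * l + 1)"
      using c(1,2) by (intro INF_lower2[of c] ennreal_leI) auto
  qed
  moreover have "K + 1 > 0" using K(1) by simp
  ultimately show ?thesis
    unfolding linear_class_iff by (intro exI[of _ 1] conjI exI[of _ "K + 1"]) auto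
qed

text \<open>The existence of a resolution gives the inclusion of the linear class into
  \<open>DFV\<close>, the upper bound gives the converse. The second part covers resolutions in any
  type.\<close>

theorem corollary4p3:
  assumes "hyperbolic_group TYPE('g::group_add)"
  shows "DFV 1 TYPE('r::ring_1) TYPE('g) TYPE(('r, 'g) universe) = linear_class \<and>
    (\<forall>(X :: ('r, 'g, 'm::ab_group_add) resolution) B.
       n_admissible 1 X B \<longrightarrow> isoperimetric_function 1 X B \<in> linear_class)"
proof (intro conjI allI impI)
  obtain S \<delta> where "hyperbolic_generators (S :: 'g set) \<delta>"
    using assms unfolding hyperbolic_group_def gromov_hyperbolic_def hyperbolic_generators_def
    by blast
  then obtain X :: "('r, 'g, ('r, 'g) universe) resolution" and B where X: "n_admissible 1 X B"
    using admissible_resolution_exists by blast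
  show "DFV 1 TYPE('r) TYPE('g) TYPE(('r, 'g) universe) = linear_class"
  proof (intro equalityI subsetI)
    fix f assume "f \<in> DFV 1 TYPE('r) TYPE('g) TYPE(('r, 'g) universe)"
    thus "f \<in> linear_class"
      unfolding DFV_def equivalent_growth_def
      using dominated_linear isoperimetric_function_linear[OF assms] by blast
  next
    fix f assume "f \<in> linear_class"
    hence "f \<approx>\<^sub>F isoperimetric_function 1 X B"
      using linear_dominated isoperimetric_function_linear[OF assms X]
      by (simp add: equivalent_growth_def)
    thus "f \<in> DFV 1 TYPE('r) TYPE('g) TYPE(('r, 'g) universe)"
      unfolding DFV_def using X by blast
  qed
next
  fix X :: "('r, 'g, 'm) resolution" and B
  assume "n_admissible 1 X B"
  thus "isoperimetric_function 1 X B \<in> linear_class"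
    by (rule isoperimetric_function_linear[OF assms])
qed

end
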